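(* Let $\mathcal{Y}\subset\mathbb{R}^m$ be compact and let $\nu$ be a Borel measure on $\mathbb{R}^m$ with $\mathrm{supp}(\nu)=\mathcal{Y}$ and $\int_{\mathcal{Y}}|h|\,\mathrm{d}\nu<\infty$ for all $h\in\mathbb{R}[\boldsymbol{y}]$. Let $F\in\mathbb{S}[\boldsymbol{x}]^p$ and $G\in\mathbb{S}[\boldsymbol{x},\boldsymbol{y}]^q$ be homogeneous in $\boldsymbol{x}$, let $$\mathcal{X}=\{\boldsymbol{x}\in\mathbb{R}^n\mid G(\boldsymbol{x},\boldsymbol{y})\succeq 0,\ \forall\boldsymbol{y}\in\mathcal{Y}\},$$ and suppose $F(\boldsymbol{x})\succ 0$ for all $\boldsymbol{x}\in(\mathbb{R}^n_+\cap\mathcal{X})\setminus\{\mathbf{0}\}$. Then there exist $N\in\mathbb{N}$ and polynomial matrices $$P_0=\sum_{|\alpha|=N+\deg F}P_{0,\alpha}\boldsymbol{x}^\alpha\in\mathbb{S}[\boldsymbol{x}]^p,\qquad P=\sum_{|\alpha|=N+\deg F-\deg_{\boldsymbol{x}}G}P_\alpha(\boldsymbol{y})\boldsymbol{x}^\alpha\in\mathbb{S}[\boldsymbol{x},\boldsymbol{y}]^{pq},$$ homogeneous in $\boldsymbol{x}$, such that $P_{0,\alpha}\succ 0$ for all $|\alpha|=N+\deg F$, $P_\alpha(\boldsymbol{y})\succ 0$ for all $|\alpha|=N+\deg F-\deg_{\boldsymbol{x}}G$ and all $\boldsymbol{y}\in\mathcal{Y}$, and $$\left(\sum_{i=1}^n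 x_i\right)^{N}F(\boldsymbol{x})=P_0(\boldsymbol{x})+\int_{\mathcal{Y}}\langle P(\boldsymbol{x},\boldsymbol{y}),G(\boldsymbol{x},\boldsymbol{y})\rangle_p\,\mathrm{d}\nu(\boldsymbol{y}).$$
   Context: $\boldsymbol{x}=(x_1,\ldots,x_n)$, $\boldsymbol{y}=(y_1,\ldots,y_m)$; $\mathbb{N}$ includes $0$; $\mathbb{R}^n_+$ is the nonnegative orthant; for $\alpha\in\mathbb{N}^n$, $|\alpha|=\alpha_1+\cdots+\alpha_n$. $\mathbb{S}[\cdot]^q$ denotes $q\times q$ symmetric matrices with real polynomial entries in the indicated variables. For a polynomial matrix $T$, $\deg T$ (resp. $\deg_{\boldsymbol{x}}T$) is the maximum over entries of the total degree (resp. total degree in $\boldsymbol{x}$); $T$ is homogeneous in $\boldsymbol{x}$ if all entries are homogeneous in $\boldsymbol{x}$ of one common degree. For $A\in\mathbb{R}^{pq\times pq}$, $B\in\mathbb{R}^{q\times q}$, $\langle A,B\rangle_p:=\mathrm{tr}_p(A^{\intercal}(I_p\otimes B))\in\mathbb{R}^{p\times p}$, where for $C=[C_{ij}]_{i,j=1}^p$ with blocks $C_{ij}\in\mathbb{R}^{q\times q}$, $\mathrm{tr}_p(C):=[\mathrm{tr}(C_{ij})]_{i,j=1}^p$; the same definition is used for polynomial matrices. For $H(\boldsymbol{x},\boldsymbol{y})=\sum_\beta H_\beta(\boldsymbol{x})\boldsymbol{y}^\beta$, $\int_{\mathcal{Y}}H\,\mathrm{d}\nu(\boldsymbol{y}):=\sum_\beta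 H_\beta(\boldsymbol{x})\int_{\mathcal{Y}}\boldsymbol{y}^\beta\,\mathrm{d}\nu(\boldsymbol{y})$. *)

theory Defs
  imports "HOL-Analysis.Analysis" "HOL-Library.Poly_Mapping"
begin

text \<open>
  Polynomials over \<open>'a\<close> in the variables \<open>x\<^sub>i\<close>, \<open>i :: 'v\<close>, as finitely supported maps from exponents
  to coefficients. The ring \<open>\<real>[x,y]\<close> is represented as \<open>\<real>[y][x]\<close>, that is \<open>('n, ('m, real) mpoly) mpoly\<close>,
  so the outer coefficients, degree and homogeneity are those with respect to \<open>x\<close>.
\<close>

type_synonym ('v, 'a) mpoly = "('v \<Rightarrow>\<^sub>0 nat) \<Rightarrow>\<^sub>0 'a"

definition mvar :: "'v \<Rightarrow> ('v, 'a::zero_neq_one) mpoly" where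
  "mvar i = Poly_Mapping.single (Poly_Mapping.single i 1) 1"

definition exp_deg :: "('v::finite \<Rightarrow>\<^sub>0 nat) \<Rightarrow> nat" where
  "exp_deg \<alpha> = (\<Sum>i\<in>UNIV. Poly_Mapping.lookup \<alpha> i)"

definition monom_at :: "('v::finite \<Rightarrow>\<^sub>0 nat) \<Rightarrow> real^'v \<Rightarrow> real" where
  "monom_at \<alpha> x = (\<Prod>i\<in>UNIV. (x $ i) ^ Poly_Mapping.lookup \<alpha> i)"

definition peval :: "('v::finite, real) mpoly \<Rightarrow> real^'v \<Rightarrow> real" where
  "peval h x = (\<Sum>\<alpha>\<in>Poly_Mapping.keys h. Poly_Mapping.lookup h \<alpha> * monom_at \<alpha> x)"

definition peval2 :: "('n::finite, ('m::finite, real) mpoly) mpoly \<Rightarrow> real^'n \<Rightarrow> real^'m \<Rightarrow> real" where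
  "peval2 h x y = (\<Sum>\<alpha>\<in>Poly_Mapping.keys h. peval (Poly_Mapping.lookup h \<alpha>) y * monom_at \<alpha> x)"

definition mat_eval :: "('v::finite, real) mpoly^'k^'l \<Rightarrow> real^'v \<Rightarrow> real^'k^'l" where
  "mat_eval T x = (\<chi> i j. peval (T $ i $ j) x)"

definition mat_eval2 ::
  "('n::finite, ('m::finite, real) mpoly) mpoly^'k^'l \<Rightarrow> real^'n \<Rightarrow> real^'m \<Rightarrow> real^'k^'l" where
  "mat_eval2 T x y = (\<chi> i j. peval2 (T $ i $ j) x y)"

definition mat_coeff :: "('v, 'a::zero) mpoly^'k^'l \<Rightarrow> ('v \<Rightarrow>\<^sub>0 nat) \<Rightarrow> 'a^'k^'l" where
  "mat_coeff T \<alpha> = (\<chi> i j. Poly_Mapping.lookup (T $ i $ j) \<alpha>)"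

text \<open>The degree of the zero polynomial is \<open>0\<close>, and the zero polynomial is homogeneous of every degree.\<close>

definition pdeg :: "('v::finite, 'a::zero) mpoly \<Rightarrow> nat" where
  "pdeg h = Max (insert 0 (exp_deg ` Poly_Mapping.keys h))"

definition mat_deg :: "('v::finite, 'a::zero) mpoly^'k::finite^'l::finite \<Rightarrow> nat" where
  "mat_deg T = Max {pdeg (T $ i $ j) | i j. True}"

definition homogeneous_of_degree :: "nat \<Rightarrow> ('v::finite, 'a::zero) mpoly^'k^'l \<Rightarrow> bool" where
  "homogeneous_of_degree d T \<longleftrightarrow> (\<forall>i j. \<forall>\<alpha>\<in>Poly_Mapping.keys (T $ i $ j). exp_deg \<alpha> = d)"

definition homogeneous :: "('v::finite, 'a::zero) mpoly^'k^'l \<Rightarrow> bool" where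
  "homogeneous T \<longleftrightarrow> (\<exists>d. homogeneous_of_degree d T)"

definition symmetric :: "'a^'k^'k \<Rightarrow> bool" where
  "symmetric A \<longleftrightarrow> transpose A = A"

definition pos_semidef :: "real^'k::finite^'k \<Rightarrow> bool" where
  "pos_semidef A \<longleftrightarrow> symmetric A \<and> (\<forall>v. 0 \<le> v \<bullet> (A *v v))"

definition pos_def :: "real^'k::finite^'k \<Rightarrow> bool" where
  "pos_def A \<longleftrightarrow> symmetric A \<and> (\<forall>v. v \<noteq> 0 \<longrightarrow> 0 < v \<bullet> (A *v v))"

text \<open>
  Rows and columns of \<open>pq \<times> pq\<close> matrices are indexed by \<open>'p \<times> 'q\<close>; the first component selects
  the block, the second one the position inside the \<open>q \<times> q\<close> block.
\<close>

definition kron :: "'a::times^'p::finite^'p \<Rightarrow> 'a^'q::finite^'q \<Rightarrow> 'a^('p \<times> 'q)^('p \<times> 'q)" where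
  "kron A B = (\<chi> r s. A $ fst r $ fst s * B $ snd r $ snd s)"

definition partial_trace :: "'a::semiring_1^('p::finite \<times> 'q::finite)^('p \<times> 'q) \<Rightarrow> 'a^'p^'p" where
  "partial_trace C = (\<chi> i j. trace ((\<chi> k l. C $ (i, k) $ (j, l)) :: 'a^'q^'q))"

definition inner_p :: "'a::semiring_1^('p::finite \<times> 'q::finite)^('p \<times> 'q) \<Rightarrow> 'a^'q^'q \<Rightarrow> 'a^'p^'p" where
  "inner_p A B = partial_trace (transpose A ** kron (mat 1) B)"

definition measure_support :: "'a::topological_space measure \<Rightarrow> 'a set" where
  "measure_support \<nu> = {y. \<forall>U. open U \<and> y \<in> U \<longrightarrow> 0 < emeasure \<nu> U}"

text \<open>
  Integration over \<open>Y\<close> of a polynomial in \<open>\<real>[y][x]\<close>: monomials in \<open>y\<close> are replaced by their moments,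
  which leaves a polynomial in \<open>x\<close>.
\<close>

definition moment_functional :: "(real^'m) measure \<Rightarrow> (real^'m) set \<Rightarrow> ('m::finite, real) mpoly \<Rightarrow> real" where
  "moment_functional \<nu> Y h =
     (\<Sum>\<beta>\<in>Poly_Mapping.keys h. Poly_Mapping.lookup h \<beta> * (LINT y:Y|\<nu>. monom_at \<beta> y))"

definition mat_integral ::
  "(real^'m) measure \<Rightarrow> (real^'m) set \<Rightarrow> ('n, ('m::finite, real) mpoly) mpoly^'k^'l \<Rightarrow> ('n, real) mpoly^'k^'l" where
  "mat_integral \<nu> Y H = (\<chi> i j. Poly_Mapping.map (moment_functional \<nu> Y) (H $ i $ j))"

end

theory Submission
  imports Defs
begin

text \<open>
  The multiplier is sought in the block form \<open>P = I\<^sub>p \<otimes> Q\<close>. For such \<open>P\<close> the pairing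
  \<open>\<langle>P, G\<rangle>\<^sub>p\<close> is the scalar \<open>tr(Q\<^sup>T G)\<close> times the identity (\<open>inner_p_kron_id\<close>), so the matrix
  structure of \<open>F\<close> only enters through quadratic forms.

  On the standard simplex there is a matrix field \<open>B(x)\<close>, polynomial in \<open>y\<close>, continuous in \<open>x\<close> and
  positive definite, with \<open>F(x) - (\<integral> tr(B(x)\<^sup>T G(x,y)) d\<nu>) I \<succ> 0\<close> (\<open>continuous_multiplier_field\<close>).
  At a single point \<open>x\<close> this is easy. If \<open>x\<close> lies in \<open>X\<close>, then \<open>F(x) \<succ> 0\<close> and a small multiple of the
  identity works. Otherwise \<open>g(y) = v\<^sup>T G(x,y) v\<close> is negative at some point of the support of \<open>\<nu>\<close>; the
  squares \<open>(1 - g/C)\<^sup>2\<^sup>k\<close>, with \<open>C\<close> a bound of \<open>\<bar>g\<bar>\<close> on \<open>Y\<close>, blow up where \<open>g < 0\<close> and are at most \<open>1\<close>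
  elsewhere, so \<open>\<integral> (1 - g/C)\<^sup>2\<^sup>k g d\<nu> \<rightarrow> -\<infinity>\<close> (\<open>concentrated_square_moment\<close>) and
  \<open>(1 - g/C)\<^sup>2\<^sup>k v v\<^sup>T + I\<close> works for large \<open>k\<close>. The condition is open in \<open>x\<close> and convex in the multiplier,
  hence a partition of unity on the compact simplex glues the local choices.

  The field is then turned into a polynomial by sampling, in the manner of Bernstein polynomials: the
  coefficient of \<open>x\<^sup>\<alpha>\<close> in \<open>Q\<close> is a positive multiple, proportional to \<open>1/\<alpha>!\<close>, of \<open>B(\<alpha>/K)\<close>, where \<open>K\<close> is
  the degree of \<open>Q\<close>. So positive definiteness of the coefficients of \<open>P\<close> holds by construction. The
  remaining claim, about the coefficients of
  \<open>(x\<^sub>1 + \<dots> + x\<^sub>n)\<^sup>N F - tr(Q\<^sup>T G) I\<close>, where the moments in \<open>y\<close> have been taken, is the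
  argument behind Polya's theorem. Put \<open>M = N + deg F\<close>. Up to a positive factor, the coefficient at
  \<open>\<alpha>\<close> is the value at \<open>h = 1/M\<close>, \<open>x = \<alpha>/M\<close> of an expression that is jointly continuous in \<open>(h, x)\<close>:
  each monomial \<open>x\<^sup>\<gamma>\<close> is replaced by the falling product \<open>\<Prod>\<^sub>i x\<^sub>i (x\<^sub>i - h) \<dots> (x\<^sub>i - (\<gamma>\<^sub>i - 1) h)\<close>, and \<open>B\<close> is
  evaluated at \<open>(x - h \<gamma>) / (1 - deg\<^sub>x G h)\<close>. At \<open>h = 0\<close> this is the matrix that is positive definite
  on the simplex, and compactness gives positivity for all small \<open>h\<close>
  (\<open>eventually_positive_falling_form\<close>). Thus one \<open>N\<close> serves all \<open>\<alpha>\<close> at once.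
\<close>

section \<open>Exponents and products of polynomials\<close>
definition exponents :: "nat \<Rightarrow> ('v::finite \<Rightarrow>\<^sub>0 nat) set" where
  "exponents d = {\<alpha>. exp_deg \<alpha> = d}"

lemma finite_exponents: "finite (exponents d :: ('v::finite \<Rightarrow>\<^sub>0 nat) set)"
proof -
  have "Poly_Mapping.lookup ` (exponents d :: ('v \<Rightarrow>\<^sub>0 nat) set) \<subseteq> (\<Pi>\<^sub>E i\<in>UNIV. {..d})"
    by (auto simp: exponents_def exp_deg_def PiE_iff intro: member_le_sum)
  moreover have "finite (\<Pi>\<^sub>E i\<in>(UNIV::'v set). {..d})"
    by (intro finite_PiE) auto
  ultimately have "finite (Poly_Mapping.lookup ` (exponents d :: ('v \<Rightarrow>\<^sub>0 nat) set))"
    by (rule finite_subset)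
  then show ?thesis
    by (rule finite_imageD) (auto simp: inj_on_def)
qed

lemma exp_deg_add: "exp_deg (\<alpha> + \<beta>) = exp_deg \<alpha> + exp_deg \<beta>"
  by (simp add: exp_deg_def lookup_add sum.distrib)

lemma exp_deg_unit [simp]: "exp_deg (Poly_Mapping.single i (Suc 0)) = Suc 0"
  by (simp add: exp_deg_def lookup_single when_def)

lemma exp_add_diff_iff:
  "\<gamma> + (\<alpha> - \<gamma>) = \<alpha> \<longleftrightarrow> (\<forall>i. Poly_Mapping.lookup \<gamma> i \<le> Poly_Mapping.lookup (\<alpha> :: 'v \<Rightarrow>\<^sub>0 nat) i)"
  by (simp add: poly_mapping_eq_iff fun_eq_iff lookup_add lookup_minus) (metis le_add_diff_inverse le_add1)

text \<open>
  Exponents are subtracted by truncation, so \<open>\<gamma> + (\<alpha> - \<gamma>) = \<alpha>\<close> says that \<open>x\<^sup>\<gamma>\<close> divides \<open>x\<^sup>\<alpha>\<close>. The sum may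
  run over any superset of the support, in particular over all exponents of one degree, which
  frees homogeneous polynomials from their individual supports.
\<close>
lemma lookup_mult_sum:
  fixes f q :: "('v \<Rightarrow>\<^sub>0 nat) \<Rightarrow>\<^sub>0 'a::comm_semiring_0"
  assumes "finite S" "Poly_Mapping.keys f \<subseteq> S"
  shows "Poly_Mapping.lookup (f * q) \<alpha> =
    (\<Sum>\<gamma>\<in>S. if \<gamma> + (\<alpha> - \<gamma>) = \<alpha> then Poly_Mapping.lookup f \<gamma> * Poly_Mapping.lookup q (\<alpha> - \<gamma>) else 0)"
proof -
  have inner: "(\<Sum>\<delta>. Poly_Mapping.lookup q \<delta> when \<alpha> = \<gamma> + \<delta>) =
      (if \<gamma> + (\<alpha> - \<gamma>) = \<alpha> then Poly_Mapping.lookup q (\<alpha> - \<gamma>) else 0)" for \<gamma>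
  proof (cases "\<gamma> + (\<alpha> - \<gamma>) = \<alpha>")
    case True
    then have "(\<lambda>\<delta>. Poly_Mapping.lookup q \<delta> when \<alpha> = \<gamma> + \<delta>) = (\<lambda>\<delta>. Poly_Mapping.lookup q \<delta> when \<delta> = \<alpha> - \<gamma>)"
      by (auto simp: fun_eq_iff when_def)
    with True show ?thesis by (simp only: Sum_any_when_equal simp_thms if_True)
  next
    case False
    then have "(Poly_Mapping.lookup q \<delta> when \<alpha> = \<gamma> + \<delta>) = 0" for \<delta>
      by (auto simp: when_def)
    then show ?thesis using False by simp
  qed
  have "Poly_Mapping.lookup (f * q) \<alpha> = (\<Sum>\<gamma>. if \<gamma> + (\<alpha> - \<gamma>) = \<alpha>
      then Poly_Mapping.lookup f \<gamma> * Poly_Mapping.lookup q (\<alpha> - \<gamma>) else 0)"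
    by (simp add: lookup_mult inner if_distrib cong: if_cong)
  also have "\<dots> = (\<Sum>\<gamma>\<in>S. if \<gamma> + (\<alpha> - \<gamma>) = \<alpha>
      then Poly_Mapping.lookup f \<gamma> * Poly_Mapping.lookup q (\<alpha> - \<gamma>) else 0)"
    by (rule Sum_any.expand_superset) (use assms in \<open>auto simp: in_keys_iff subset_iff dest!: mult_not_zero split: if_splits\<close>)
  finally show ?thesis .
qed

abbreviation const_poly :: "'a::zero \<Rightarrow> ('v, 'a) mpoly" where
  "const_poly c \<equiv> Poly_Mapping.single 0 c"

section \<open>Evaluation of polynomials\<close>

lemma monom_at_add: "monom_at (\<alpha> + \<beta>) x = monom_at \<alpha> x * monom_at \<beta> x"
  by (simp add: monom_at_def lookup_add power_add prod.distrib)

lemma monom_at_0 [simp]: "monom_at 0 x = 1"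
  by (simp add: monom_at_def)

lemma peval_superset:
  assumes "finite S" "Poly_Mapping.keys h \<subseteq> S"
  shows "peval h x = (\<Sum>\<alpha>\<in>S. Poly_Mapping.lookup h \<alpha> * monom_at \<alpha> x)"
  unfolding peval_def using assms by (intro sum.mono_neutral_left) (auto simp: in_keys_iff)

lemma peval_add: "peval (f + g) x = peval f x + peval g x"
  using keys_add[of f g]
  by (simp add: peval_superset[of "Poly_Mapping.keys f \<union> Poly_Mapping.keys g"] lookup_add
      distrib_right sum.distrib)

lemma peval_0 [simp]: "peval 0 x = 0"
  by (simp add: peval_def)

lemma peval_sum: "peval (sum f S) x = (\<Sum>s\<in>S. peval (f s) x)"
  by (induction S rule: infinite_finite_induct) (auto simp: peval_add)

lemma peval_single: "peval (Poly_Mapping.single \<alpha> c) x = c * monom_at \<alpha> x"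
  by (subst peval_superset[of "{\<alpha>}"]) auto

lemma poly_mapping_sum_singles:
  "(f :: 'a \<Rightarrow>\<^sub>0 'b::comm_monoid_add) = (\<Sum>\<alpha>\<in>Poly_Mapping.keys f. Poly_Mapping.single \<alpha> (Poly_Mapping.lookup f \<alpha>))"
  by (rule poly_mapping_eqI) (simp add: lookup_sum lookup_single when_def in_keys_iff)

lemma peval_mult: "peval (f * g) x = peval f x * peval g x"
proof -
  have "f * g = (\<Sum>\<alpha>\<in>Poly_Mapping.keys f. \<Sum>\<beta>\<in>Poly_Mapping.keys g.
      Poly_Mapping.single (\<alpha> + \<beta>) (Poly_Mapping.lookup f \<alpha> * Poly_Mapping.lookup g \<beta>))"
    by (subst poly_mapping_sum_singles[of f], subst poly_mapping_sum_singles[of g])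
      (simp add: sum_product mult_single)
  then have "peval (f * g) x = (\<Sum>\<alpha>\<in>Poly_Mapping.keys f. \<Sum>\<beta>\<in>Poly_Mapping.keys g.
      (Poly_Mapping.lookup f \<alpha> * monom_at \<alpha> x) * (Poly_Mapping.lookup g \<beta> * monom_at \<beta> x))"
    by (simp add: peval_sum peval_single monom_at_add ac_simps)
  then show ?thesis
    by (simp add: peval_def sum_product)
qed

lemma peval_1 [simp]: "peval 1 x = 1"
  unfolding single_one[symmetric] peval_single by simp

lemma peval_power: "peval (f ^ n) x = peval f x ^ n"
  by (induction n) (auto simp: peval_mult)

lemma peval_minus: "peval (f - g) x = peval f x - peval g x"
  using peval_add[of "f - g" g x] by simp

lemmas peval_simps = peval_add peval_sum peval_mult peval_power peval_minus peval_single

lemma continuous_on_monom_at [continuous_intros]: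
  "continuous_on S f \<Longrightarrow> continuous_on S (\<lambda>x. monom_at \<alpha> (f x))"
  unfolding monom_at_def by (intro continuous_intros)

lemma continuous_on_peval [continuous_intros]:
  "continuous_on S f \<Longrightarrow> continuous_on S (\<lambda>x. peval h (f x))"
  unfolding peval_def by (intro continuous_intros)

section \<open>Coefficients of powers of the sum of variables\<close>

definition multi_fact :: "('v::finite \<Rightarrow>\<^sub>0 nat) \<Rightarrow> real" where
  "multi_fact \<alpha> = (\<Prod>i\<in>UNIV. fact (Poly_Mapping.lookup \<alpha> i))"

definition exp_vec :: "('v::finite \<Rightarrow>\<^sub>0 nat) \<Rightarrow> real^'v" where
  "exp_vec \<alpha> = (\<chi> i. of_nat (Poly_Mapping.lookup \<alpha> i))"

text \<open>
  A deformation of the monomial \<open>x\<^sup>\<gamma>\<close>, to which it reduces at \<open>h = 0\<close>. At \<open>h = 1/M\<close> and \<open>x = \<alpha>/M\<close> it is,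
  up to a power of \<open>M\<close>, the ratio \<open>\<alpha>! / (\<alpha> - \<gamma>)!\<close> of multinomial denominators.
\<close>
definition falling_monom :: "('v::finite \<Rightarrow>\<^sub>0 nat) \<Rightarrow> real \<Rightarrow> real^'v \<Rightarrow> real" where
  "falling_monom \<gamma> h x = (\<Prod>i\<in>UNIV. \<Prod>l<Poly_Mapping.lookup \<gamma> i. x $ i - of_nat l * h)"

lemma falling_monom_0: "falling_monom \<gamma> 0 x = monom_at \<gamma> x"
  by (simp add: falling_monom_def monom_at_def)

lemma prod_falling_nat:
  "(\<Prod>l<g. real a - real l) = (if g \<le> a then fact a / fact (a - g) else 0)"
proof (induction g)
  case (Suc g)
  show ?case
  proof (cases "Suc g \<le> a")
    case True
    then have "fact (a - g) = real (a - g) * fact (a - Suc g)"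
      by (metis Suc_diff_Suc Suc_le_lessD fact_Suc of_nat_mult of_nat_fact)
    with True Suc show ?thesis by (simp add: field_simps of_nat_diff)
  next
    case False
    with Suc show ?thesis by (cases "g = a") auto
  qed
qed auto

text \<open>
  If \<open>x\<^sup>\<gamma>\<close> does not divide \<open>x\<^sup>\<alpha>\<close>, then \<open>\<alpha>\<^sub>i - l = 0\<close> for some \<open>l < \<gamma>\<^sub>i\<close>, and the product vanishes; the terms
  absent from a coefficient of a product of polynomials therefore need no separate treatment.
\<close>
lemma falling_monom_scaled:
  assumes "M > 0"
  shows "falling_monom \<gamma> (1 / M) (exp_vec \<alpha> /\<^sub>R M) =
    (if \<gamma> + (\<alpha> - \<gamma>) = \<alpha> then multi_fact \<alpha> / multi_fact (\<alpha> - \<gamma>) else 0) / M ^ exp_deg \<gamma>"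
proof -
  let ?l = Poly_Mapping.lookup
  have "falling_monom \<gamma> (1 / M) (exp_vec \<alpha> /\<^sub>R M) = (\<Prod>i\<in>UNIV. \<Prod>l<?l \<gamma> i. (?l \<alpha> i - real l) / M)"
    by (simp add: falling_monom_def exp_vec_def diff_divide_distrib divide_inverse ac_simps right_diff_distrib)
  also have "\<dots> = (\<Prod>i\<in>UNIV. (\<Prod>l<?l \<gamma> i. ?l \<alpha> i - real l) / M ^ ?l \<gamma> i)"
    by (simp add: prod_dividef)
  also have "\<dots> = (\<Prod>i\<in>UNIV. \<Prod>l<?l \<gamma> i. ?l \<alpha> i - real l) / M ^ exp_deg \<gamma>"
    by (simp add: prod_dividef exp_deg_def power_sum)
  also have "(\<Prod>i\<in>UNIV. \<Prod>l<?l \<gamma> i. ?l \<alpha> i - real l) =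
      (if \<gamma> + (\<alpha> - \<gamma>) = \<alpha> then multi_fact \<alpha> / multi_fact (\<alpha> - \<gamma>) else 0)"
    by (auto simp: exp_add_diff_iff prod_falling_nat multi_fact_def lookup_minus prod_dividef)
  finally show ?thesis .
qed

text \<open>
  The multinomial theorem. Multiplying by the sum of the variables replaces \<open>N!/\<beta>!\<close> by
  \<open>\<Sum>\<^sub>k N! \<beta>\<^sub>k / \<beta>! = N! (N + 1) / \<beta>!\<close>, which is the induction step.
\<close>
lemma lookup_sum_vars_power:
  "Poly_Mapping.lookup ((\<Sum>k\<in>UNIV. mvar k) ^ N :: ('v::finite, real) mpoly) \<beta> =
    (if exp_deg \<beta> = N then fact N / multi_fact \<beta> else 0)"
proof (induction N arbitrary: \<beta>)
  case 0
  have "exp_deg \<beta> = 0 \<longleftrightarrow> \<beta> = 0"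
    by (auto simp: exp_deg_def poly_mapping_eq_iff fun_eq_iff)
  then show ?case by (simp add: lookup_one when_def multi_fact_def)
next
  case (Suc N)
  let ?l = Poly_Mapping.lookup and ?e = "\<lambda>k::'v. Poly_Mapping.single k (1::nat)"
  define s where "s = ((\<Sum>k\<in>UNIV. mvar k) ^ N :: ('v, real) mpoly)"
  have one: "?l (mvar k * s) \<beta> = (if exp_deg \<beta> = Suc N then fact N / multi_fact \<beta> * ?l \<beta> k else 0)" for k
  proof (cases "?e k + (\<beta> - ?e k) = \<beta>")
    case True
    have "?l (mvar k * s) \<beta> = ?l s (\<beta> - ?e k)"
      by (subst lookup_mult_sum[of "{?e k}"]) (use True in \<open>auto simp: mvar_def\<close>)
    moreover have "exp_deg \<beta> = Suc (exp_deg (\<beta> - ?e k))"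
      using exp_deg_add[of "?e k" "\<beta> - ?e k"] True by simp
    moreover have "multi_fact \<beta> = multi_fact (\<beta> - ?e k) * ?l \<beta> k"
    proof -
      have "?l \<beta> k > 0"
        using True unfolding exp_add_diff_iff by (metis lookup_single_eq Suc_le_eq One_nat_def)
      then have "fact (?l \<beta> k) = real (?l \<beta> k) * fact (?l \<beta> k - 1)"
        by (simp add: fact_reduce)
      moreover have "(\<Prod>i\<in>UNIV - {k}. fact (?l (\<beta> - ?e k) i)) = (\<Prod>i\<in>UNIV - {k}. fact (?l \<beta> i) :: real)"
        by (intro prod.cong) (auto simp: lookup_minus lookup_single)
      ultimately show ?thesis
        by (simp add: multi_fact_def prod.remove[of UNIV k] lookup_minus)
    qed
    moreover have "multi_fact \<beta> \<noteq> 0" by (simp add: multi_fact_def)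
    ultimately show ?thesis using Suc.IH[of "\<beta> - ?e k"] by (simp add: s_def)
  next
    case False
    have "?l (mvar k * s) \<beta> = 0"
      by (subst lookup_mult_sum[of "{?e k}"]) (use False in \<open>auto simp: mvar_def\<close>)
    moreover have "?l \<beta> k = 0"
      using False by (auto simp: exp_add_diff_iff lookup_single when_def Suc_le_eq split: if_splits)
    ultimately show ?thesis by simp
  qed
  have "?l ((\<Sum>k\<in>UNIV. mvar k) ^ Suc N) \<beta> = (\<Sum>k\<in>UNIV. ?l (mvar k * s) \<beta>)"
    by (simp add: s_def sum_distrib_right lookup_sum)
  also have "\<dots> = (if exp_deg \<beta> = Suc N then (\<Sum>k\<in>UNIV. fact N / multi_fact \<beta> * real (?l \<beta> k)) else 0)"
    by (simp add: one)
  also have "\<dots> = (if exp_deg \<beta> = Suc N then fact N / multi_fact \<beta> * real (exp_deg \<beta>) else 0)"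
    by (simp only: sum_distrib_left[symmetric] exp_deg_def of_nat_sum)
  finally show ?case by (simp add: ac_simps)
qed

section \<open>Quadratic forms, Kronecker products and the partial trace\<close>

lemma inner_matrix_vector_sum:
  "v \<bullet> ((A :: real^'k^'k) *v v) = (\<Sum>i\<in>UNIV. \<Sum>j\<in>UNIV. v $ i * v $ j * A $ i $ j)"
  by (simp add: inner_vec_def matrix_vector_mult_def sum_distrib_left ac_simps)

lemma symmetric_iff: "symmetric A \<longleftrightarrow> (\<forall>i j. A $ i $ j = A $ j $ i)"
  by (auto simp: symmetric_def transpose_def vec_eq_iff)

lemma pos_def_iff_unit:
  "pos_def A \<longleftrightarrow> symmetric A \<and> (\<forall>v\<in>sphere 0 1. 0 < v \<bullet> (A *v v))"
proof (intro iffI conjI)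
  assume A: "symmetric A \<and> (\<forall>v\<in>sphere 0 1. 0 < v \<bullet> (A *v v))"
  have "0 < v \<bullet> (A *v v)" if "v \<noteq> 0" for v
  proof -
    have "0 < (v /\<^sub>R norm v) \<bullet> (A *v (v /\<^sub>R norm v))"
      by (rule bspec[OF conjunct2[OF A]]) (simp add: that)
    also have "A *v (v /\<^sub>R norm v) = (A *v v) /\<^sub>R norm v"
      by (rule linear_scale[OF matrix_vector_mul_linear])
    finally show ?thesis
      using that by (simp only: inner_scaleR_left inner_scaleR_right) (simp add: zero_less_mult_iff)
  qed
  then show "pos_def A" using A by (simp add: pos_def_def)
qed (auto simp: pos_def_def, metis norm_zero zero_neq_one)

lemma sum_entries_swap:
  "(\<Sum>i\<in>I. \<Sum>j\<in>J. \<Sum>k\<in>K. f i j k) = (\<Sum>k\<in>K. \<Sum>i\<in>I. \<Sum>j\<in>J. f i j k)"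
proof -
  have "(\<Sum>i\<in>I. \<Sum>j\<in>J. \<Sum>k\<in>K. f i j k) = (\<Sum>i\<in>I. \<Sum>k\<in>K. \<Sum>j\<in>J. f i j k)"
    by (intro sum.cong refl sum.swap)
  also have "\<dots> = (\<Sum>k\<in>K. \<Sum>i\<in>I. \<Sum>j\<in>J. f i j k)"
    by (rule sum.swap)
  finally show ?thesis .
qed

definition frob :: "'a::comm_semiring_1^'q::finite^'q \<Rightarrow> 'a^'q^'q \<Rightarrow> 'a" where
  "frob A B = (\<Sum>i\<in>UNIV. \<Sum>j\<in>UNIV. A $ i $ j * B $ i $ j)"

lemma sum_UNIV_prod: "(\<Sum>r\<in>UNIV. f r) = (\<Sum>i\<in>UNIV. \<Sum>k\<in>UNIV. f (i, k))"
  by (simp add: sum.cartesian_product flip: UNIV_Times_UNIV)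

text \<open>
  The blocks of \<open>I\<^sub>p \<otimes> Q\<close> and \<open>I\<^sub>p \<otimes> G\<close> off the diagonal vanish, so \<open>(I\<^sub>p \<otimes> Q)\<^sup>T (I\<^sub>p \<otimes> G) = I\<^sub>p \<otimes> Q\<^sup>T G\<close>,
  and the trace of each diagonal block is the Frobenius product of \<open>Q\<close> and \<open>G\<close>.
\<close>
lemma inner_p_kron_id:
  fixes Q G :: "'a::comm_semiring_1^'q::finite^'q"
  shows "inner_p (kron (mat 1) Q) G = (mat (frob Q G) :: 'a^'p::finite^'p)"
proof -
  have "(inner_p (kron (mat 1) Q) G :: 'a^'p^'p) $ i $ j = (if i = j then frob Q G else 0)" for i j
  proof -
    have "(inner_p (kron (mat 1) Q) G :: 'a^'p^'p) $ i $ j =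
      (\<Sum>k\<in>UNIV. \<Sum>h\<in>UNIV. \<Sum>l\<in>UNIV. (mat 1 $ h $ i * Q $ l $ k) * (mat 1 $ h $ j * G $ l $ k))"
      by (simp add: inner_p_def partial_trace_def trace_def matrix_matrix_mult_def transpose_def
          kron_def sum_UNIV_prod)
    also have "\<dots> = (\<Sum>k\<in>UNIV. \<Sum>h\<in>UNIV. \<Sum>l\<in>UNIV. if h = i then if h = j then Q $ l $ k * G $ l $ k else 0 else 0)"
      by (intro sum.cong refl) (simp add: mat_def)
    also have "\<dots> = (\<Sum>k\<in>UNIV. \<Sum>l\<in>UNIV. \<Sum>h\<in>UNIV. if h = i then if h = j then Q $ l $ k * G $ l $ k else 0 else 0)"
      by (intro sum.cong refl sum.swap)
    also have "\<dots> = (if i = j then \<Sum>k\<in>UNIV. \<Sum>l\<in>UNIV. Q $ l $ k * G $ l $ k else 0)"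
      by simp
    also have "(\<Sum>k\<in>UNIV. \<Sum>l\<in>UNIV. Q $ l $ k * G $ l $ k) = frob Q G"
      unfolding frob_def by (rule sum.swap)
    finally show ?thesis .
  qed
  then show ?thesis by (simp add: vec_eq_iff mat_def)
qed

lemma symmetric_kron_id:
  "symmetric Q \<Longrightarrow> symmetric (kron (mat (1::'a::semiring_1)) Q)"
  by (auto simp: symmetric_iff kron_def mat_def)

lemma pos_def_kron_id:
  fixes B :: "real^'q::finite^'q"
  assumes "pos_def B"
  shows "pos_def (kron (mat 1 :: real^'p::finite^'p) B)"
  unfolding pos_def_def
proof (intro conjI allI impI)
  show "symmetric (kron (mat 1 :: real^'p^'p) B)"
    using assms by (intro symmetric_kron_id) (simp add: pos_def_def)
next
  fix v :: "real^('p \<times> 'q)"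
  assume "v \<noteq> 0"
  define u :: "'p \<Rightarrow> real^'q" where "u = (\<lambda>i. \<chi> k. v $ (i, k))"
  have "v \<bullet> (kron (mat 1 :: real^'p^'p) B *v v) =
    (\<Sum>i\<in>UNIV. \<Sum>k\<in>UNIV. \<Sum>j\<in>UNIV. \<Sum>l\<in>UNIV. v $ (i, k) * v $ (j, l) * (if i = j then B $ k $ l else 0))"
    by (auto simp: inner_matrix_vector_sum sum_UNIV_prod kron_def mat_def intro!: sum.cong)
  also have "\<dots> = (\<Sum>i\<in>UNIV. \<Sum>k\<in>UNIV. \<Sum>l\<in>UNIV. \<Sum>j\<in>UNIV. if i = j then v $ (i, k) * v $ (j, l) * B $ k $ l else 0)"
    by (intro sum.cong refl, subst sum.swap) (auto intro!: sum.cong)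
  also have "\<dots> = (\<Sum>i\<in>UNIV. u i \<bullet> (B *v u i))"
    by (simp add: inner_matrix_vector_sum u_def)
  finally have eq: "v \<bullet> (kron (mat 1 :: real^'p^'p) B *v v) = (\<Sum>i\<in>UNIV. u i \<bullet> (B *v u i))" .
  have nonneg: "0 \<le> u i \<bullet> (B *v u i)" for i
    using assms by (cases "u i = 0") (auto simp: pos_def_def less_imp_le)
  obtain i k where "v $ (i, k) \<noteq> 0"
    using \<open>v \<noteq> 0\<close> by (auto simp: vec_eq_iff)
  then have "u i \<noteq> 0" by (auto simp: u_def vec_eq_iff)
  then have "0 < u i \<bullet> (B *v u i)" using assms by (simp add: pos_def_def)
  then show "0 < v \<bullet> (kron (mat 1 :: real^'p^'p) B *v v)"
    unfolding eq by (intro sum_pos2[of _ i]) (auto simp: nonneg)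
qed

text \<open>
  For \<open>T \<noteq> 0\<close> the degree is the common degree of the entries; \<open>T = 0\<close> is homogeneous of every degree.
\<close>
lemma homogeneous_mat_deg:
  fixes T :: "('v::finite, 'a::zero) mpoly^'k::finite^'l::finite"
  assumes "homogeneous T"
  shows "homogeneous_of_degree (mat_deg T) T"
proof -
  obtain d where d: "homogeneous_of_degree d T" using assms by (auto simp: homogeneous_def)
  show ?thesis
  proof (cases "\<exists>i j. Poly_Mapping.keys (T $ i $ j) \<noteq> {}")
    case True
    then obtain i j \<alpha> where \<alpha>: "\<alpha> \<in> Poly_Mapping.keys (T $ i $ j)" by (metis ex_in_conv)
    have le: "pdeg (T $ i $ j) \<le> d" for i j
      using d by (auto simp: pdeg_def homogeneous_of_degree_def)
    have "d \<le> pdeg (T $ i $ j)"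
      unfolding pdeg_def using \<alpha> d by (intro Max_ge) (auto simp: homogeneous_of_degree_def image_iff)
    with le have "pdeg (T $ i $ j) = d" by (metis le_antisym)
    moreover have "finite {pdeg (T $ i $ j) | i j. True}"
      by (rule finite_subset[of _ "range (\<lambda>(i, j). pdeg (T $ i $ j))"]) (auto simp: image_iff)
    ultimately have "mat_deg T = d"
      unfolding mat_deg_def using le by (intro Max_eqI) auto
    with d show ?thesis by simp
  qed (auto simp: homogeneous_of_degree_def)
qed

section \<open>Substituting a point for the outer variables\<close>

text \<open>
  Fixing \<open>x\<close> turns \<open>G(x,y)\<close> into a matrix of polynomials in \<open>y\<close> alone, to which moments apply.
\<close>
definition specialize ::
  "real^'n::finite \<Rightarrow> ('n, ('m, real) mpoly) mpoly^'k^'l \<Rightarrow> ('m, real) mpoly^'k^'l" where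
  "specialize x G = (\<chi> i j. \<Sum>\<gamma>\<in>Poly_Mapping.keys (G $ i $ j).
      const_poly (monom_at \<gamma> x) * Poly_Mapping.lookup (G $ i $ j) \<gamma>)"

lemma mat_eval_specialize: "mat_eval (specialize x G) y = mat_eval2 G x y"
  by (simp add: mat_eval_def mat_eval2_def specialize_def peval2_def peval_simps vec_eq_iff ac_simps)

lemma specialize_homogeneous:
  assumes "homogeneous_of_degree e G"
  shows "specialize x G $ i $ j = (\<Sum>\<gamma>\<in>exponents e. const_poly (monom_at \<gamma> x) * mat_coeff G \<gamma> $ i $ j)"
  unfolding specialize_def mat_coeff_def vec_lambda_beta
  using assms by (intro sum.mono_neutral_left finite_exponents)
    (auto simp: homogeneous_of_degree_def exponents_def in_keys_iff)

lemma frob_specialize: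
  assumes "homogeneous_of_degree e G"
  shows "frob B (specialize x G) = (\<Sum>\<gamma>\<in>exponents e. const_poly (monom_at \<gamma> x) * frob B (mat_coeff G \<gamma>))"
proof -
  have "frob B (specialize x G) = (\<Sum>i\<in>UNIV. \<Sum>j\<in>UNIV. \<Sum>\<gamma>\<in>exponents e.
      const_poly (monom_at \<gamma> x) * (B $ i $ j * mat_coeff G \<gamma> $ i $ j))"
    by (simp add: frob_def specialize_homogeneous[OF assms] sum_distrib_left ac_simps)
  also have "\<dots> = (\<Sum>\<gamma>\<in>exponents e. \<Sum>i\<in>UNIV. \<Sum>j\<in>UNIV.
      const_poly (monom_at \<gamma> x) * (B $ i $ j * mat_coeff G \<gamma> $ i $ j))"
    by (rule sum_entries_swap)
  finally show ?thesis by (simp add: frob_def sum_distrib_left)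
qed

section \<open>Moments of a measure with compact support\<close>

locale compact_moments =
  fixes Y :: "(real^'m::finite) set" and \<nu> :: "(real^'m) measure"
  assumes compact: "compact Y"
    and sets_borel: "sets \<nu> = sets borel"
    and support: "measure_support \<nu> = Y"
    and finite_moments: "\<And>h :: ('m, real) mpoly. (\<integral>\<^sup>+y\<in>Y. ennreal \<bar>peval h y\<bar> \<partial>\<nu>) < \<infinity>"
begin

abbreviation L :: "('m, real) mpoly \<Rightarrow> real" where
  "L \<equiv> moment_functional \<nu> Y"

lemma space_eq [simp]: "space \<nu> = UNIV"
  using sets_eq_imp_space_eq[OF sets_borel] by simp

lemma sets_Y [measurable]: "Y \<in> sets \<nu>"
  unfolding sets_borel using compact by (intro borel_closed compact_imp_closed)

lemma measurable_continuous: "continuous_on UNIV f \<Longrightarrow> f \<in> borel_measurable \<nu>"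
  by (simp add: measurable_cong_sets[OF sets_borel refl] borel_measurable_continuous_onI)

lemma integrable_peval: "set_integrable \<nu> Y (peval h)"
  unfolding set_integrable_def
proof (rule integrableI_bounded)
  have [measurable]: "peval h \<in> borel_measurable \<nu>"
    by (intro measurable_continuous continuous_intros)
  show "(\<lambda>y. indicat_real Y y *\<^sub>R peval h y) \<in> borel_measurable \<nu>"
    by measurable
  have "(\<integral>\<^sup>+y. ennreal (norm (indicat_real Y y *\<^sub>R peval h y)) \<partial>\<nu>) = (\<integral>\<^sup>+y\<in>Y. ennreal \<bar>peval h y\<bar> \<partial>\<nu>)"
    by (intro nn_integral_cong) (auto simp: indicator_def)
  then show "(\<integral>\<^sup>+y. ennreal (norm (indicat_real Y y *\<^sub>R peval h y)) \<partial>\<nu>) < \<infinity>"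
    using finite_moments[of h] by simp
qed

lemma moment_eq_integral: "L h = (LINT y:Y|\<nu>. peval h y)"
proof -
  have "set_integrable \<nu> Y (\<lambda>y. monom_at \<beta> y)" for \<beta>
    using integrable_peval[of "Poly_Mapping.single \<beta> 1"] by (simp add: peval_single[abs_def])
  then have "set_integrable \<nu> Y (\<lambda>y. Poly_Mapping.lookup h \<beta> * monom_at \<beta> y)" for \<beta>
    by (intro set_integrable_mult_right)
  then have "(LINT y:Y|\<nu>. peval h y) =
      (\<Sum>\<beta>\<in>Poly_Mapping.keys h. LINT y:Y|\<nu>. Poly_Mapping.lookup h \<beta> * monom_at \<beta> y)"
    unfolding peval_def set_lebesgue_integral_def scaleR_sum_right
    by (intro Bochner_Integration.integral_sum) (simp add: set_integrable_def)
  then show ?thesis by (simp add: moment_functional_def)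
qed

lemma moment_0 [simp]: "L 0 = 0"
  by (simp add: moment_functional_def)

lemma moment_add: "L (f + g) = L f + L g"
  unfolding moment_eq_integral peval_add by (intro set_integral_add integrable_peval)

lemma moment_sum: "L (sum f S) = (\<Sum>s\<in>S. L (f s))"
  by (induction S rule: infinite_finite_induct) (auto simp: moment_add)

lemma moment_const_mult: "L (const_poly c * h) = c * L h"
  by (simp add: moment_eq_integral peval_simps)

lemma emeasure_Y_finite: "emeasure \<nu> Y < \<infinity>"
  using finite_moments[of 1] by simp

text \<open>
  Each point outside the support has a null neighbourhood, and countably many of these cover the
  complement.
\<close>
lemma null_outside_support: "emeasure \<nu> (- Y) = 0"
proof -
  define \<U> where "\<U> = {U. open U \<and> emeasure \<nu> U = 0}"
  have "\<Union>\<U> = - Y"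
    unfolding support[symmetric] measure_support_def \<U>_def by (auto simp: not_less)
  moreover obtain \<V> where \<V>: "\<V> \<subseteq> \<U>" "countable \<V>" "\<Union>\<V> = \<Union>\<U>"
    using Lindelof[of \<U>] by (auto simp: \<U>_def)
  moreover have "(\<Union>V\<in>\<V>. V) \<in> null_sets \<nu>"
    using \<V> by (intro null_sets_UN') (auto simp: \<U>_def null_sets_def sets_borel)
  ultimately show ?thesis by auto
qed

text \<open>
  The support condition concerns \<open>U\<close>, but the integrals are over \<open>Y\<close>; the difference is a null set.
\<close>
lemma measure_near_support_point:
  assumes "y \<in> Y" "open U" "y \<in> U"
  shows "0 < measure \<nu> (Y \<inter> U)"
proof -
  have U: "U \<in> sets \<nu>" using assms by (simp add: sets_borel)
  have "0 < emeasure \<nu> U"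
    using assms support by (auto simp: measure_support_def)
  also have "emeasure \<nu> U \<le> emeasure \<nu> ((Y \<inter> U) \<union> - Y)"
    using U sets_Y by (intro emeasure_mono) (auto simp: sets_borel)
  also have "\<dots> \<le> emeasure \<nu> (Y \<inter> U) + emeasure \<nu> (- Y)"
    using U sets_Y by (intro emeasure_subadditive) (auto simp: sets_borel)
  finally have "0 < emeasure \<nu> (Y \<inter> U)" by (simp add: null_outside_support)
  moreover have "emeasure \<nu> (Y \<inter> U) \<le> emeasure \<nu> Y"
    using U by (intro emeasure_mono) auto
  ultimately show ?thesis
    using emeasure_Y_finite by (simp add: measure_def enn2real_positive_iff)
qed

end

section \<open>Multipliers at a single point\<close>

lemma inner_mat_scalar: "u \<bullet> ((mat c :: real^'q^'q) *v u) = c * (u \<bullet> u)"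
  unfolding inner_matrix_vector_sum
  by (simp add: mat_def if_distrib[where f="\<lambda>z. _ * z"] inner_vec_def
      sum_distrib_left ac_simps cong: if_cong)

lemma frob_rank_one_plus_id:
  "frob (\<chi> i j. const_poly (v $ i * v $ j) * \<psi> + mat 1 $ i $ j) H =
    \<psi> * (\<Sum>i\<in>UNIV. \<Sum>j\<in>UNIV. const_poly (v $ i * v $ j) * H $ i $ j) + frob (mat 1) H"
  by (simp add: frob_def distrib_left distrib_right sum.distrib sum_distrib_left ac_simps)

context compact_moments
begin

text \<open>
  With \<open>c = 1/C\<close> and \<open>\<bar>g\<bar> \<le> C\<close> on \<open>Y\<close>, the weight \<open>(1 - g/C)\<^sup>2\<^sup>k\<close> is at least \<open>(1 + \<delta>/C)\<^sup>2\<^sup>k\<close> on the set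
  where \<open>g < -\<delta>\<close>; for \<open>\<delta> = -g(y0)/2\<close> this set is an open neighbourhood of \<open>y0\<close>, so it has
  positive measure. The weight is at most \<open>1\<close> where \<open>g \<ge> 0\<close>. So the negative part of the weighted
  integral grows geometrically in \<open>k\<close> while the positive part stays bounded. An even
  exponent makes the weight nonnegative on the whole space.
\<close>
lemma concentrated_square_moment:
  assumes "y0 \<in> Y" and neg: "peval g y0 < 0"
  obtains c k where "L ((1 - const_poly c * g) ^ (2 * k) * g) < r"
proof -
  have "bounded (peval g ` Y)"
    by (intro compact_imp_bounded compact_continuous_image compact continuous_intros)
  then obtain C where C: "C > 0" "\<And>y. y \<in> Y \<Longrightarrow> \<bar>peval g y\<bar> \<le> C"
    by (auto simp: bounded_pos)
  define \<delta> where "\<delta> = - peval g y0 / 2"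
  define U where "U = {y. peval g y < - \<delta>}"
  define \<kappa> where "\<kappa> = measure \<nu> (Y \<inter> U)"
  have \<delta>: "\<delta> > 0" using neg by (simp add: \<delta>_def)
  have "open U"
    unfolding U_def by (intro open_Collect_less continuous_intros)
  moreover have "y0 \<in> U" using neg by (simp add: U_def \<delta>_def)
  ultimately have \<kappa>: "\<kappa> > 0"
    unfolding \<kappa>_def using \<open>y0 \<in> Y\<close> by (intro measure_near_support_point)
  have YU: "Y \<inter> U \<in> sets \<nu>"
    using \<open>open U\<close> sets_Y by (auto simp: sets_borel)
  have "1 < (1 + \<delta> / C)\<^sup>2"
    using \<delta> C by (simp add: one_less_power)
  then obtain k where "(C * measure \<nu> Y - r) / (\<delta> * \<kappa>) < ((1 + \<delta> / C)\<^sup>2) ^ k"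
    using real_arch_pow by blast
  then have "C * measure \<nu> Y - r < (1 + \<delta> / C) ^ (2 * k) * (\<delta> * \<kappa>)"
    unfolding power_mult[symmetric] using \<delta> \<kappa> by (subst (asm) pos_divide_less_eq) auto
  then have k: "C * measure \<nu> Y - \<delta> * (1 + \<delta> / C) ^ (2 * k) * \<kappa> < r"
    by (simp add: ac_simps)
  let ?\<psi> = "\<lambda>y. (1 - peval g y / C) ^ (2 * k)"
  have bound: "?\<psi> y * peval g y \<le> C - \<delta> * (1 + \<delta> / C) ^ (2 * k) * indicator U y" if "y \<in> Y" for y
  proof (cases "peval g y < 0")
    case True
    show ?thesis
    proof (cases "y \<in> U")
      case True
      then have y: "peval g y \<le> - \<delta>" by (simp add: U_def)
      have "1 + \<delta> / C \<le> 1 - peval g y / C"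
        using divide_right_mono[of \<delta> "- peval g y" C] y C by simp
      then have "(1 + \<delta> / C) ^ (2 * k) \<le> ?\<psi> y"
        using \<delta> C by (intro power_mono) auto
      then have "\<delta> * (1 + \<delta> / C) ^ (2 * k) \<le> - peval g y * ?\<psi> y"
        using y \<delta> C by (intro mult_mono) auto
      then show ?thesis using True C by (simp add: ac_simps)
    next
      case False
      have "?\<psi> y * peval g y \<le> 0"
        using True by (intro mult_nonneg_nonpos) auto
      then show ?thesis using False C by simp
    qed
  next
    case False
    then have "y \<notin> U" using \<delta> by (auto simp: U_def)
    moreover have "?\<psi> y * peval g y \<le> 1 * C"
      using False C(2)[OF that] C(1)
      by (intro mult_mono power_le_one) (auto simp: field_simps)
    ultimately show ?thesis by simp
  qed
  have intU: "integrable \<nu> (\<lambda>y. C * indicator Y y)"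
     "integrable \<nu> (\<lambda>y. \<delta> * (1 + \<delta> / C) ^ (2 * k) * indicator (Y \<inter> U) y)"
    using YU emeasure_Y_finite emeasure_mono[of "Y \<inter> U" Y \<nu>]
    by (auto intro!: integrable_mult_right integrable_real_indicator simp: order.strict_trans1)
  have split: "indicat_real Y y *\<^sub>R (C - \<delta> * (1 + \<delta> / C) ^ (2 * k) * indicator U y) =
      C * indicator Y y - \<delta> * (1 + \<delta> / C) ^ (2 * k) * indicator (Y \<inter> U) y" for y
    by (auto simp: indicator_def)
  have "L ((1 - const_poly (1 / C) * g) ^ (2 * k) * g) = (LINT y:Y|\<nu>. ?\<psi> y * peval g y)"
    by (simp add: moment_eq_integral peval_simps)
  also have "\<dots> \<le> (LINT y:Y|\<nu>. C - \<delta> * (1 + \<delta> / C) ^ (2 * k) * indicator U y)"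
  proof (rule set_integral_mono)
    show "set_integrable \<nu> Y (\<lambda>y. ?\<psi> y * peval g y)"
      using integrable_peval[of "(1 - const_poly (1 / C) * g) ^ (2 * k) * g"]
      by (simp add: peval_simps cong: set_integrable_cong)
    show "set_integrable \<nu> Y (\<lambda>y. C - \<delta> * (1 + \<delta> / C) ^ (2 * k) * indicator U y)"
      unfolding set_integrable_def split by (intro Bochner_Integration.integrable_diff intU)
  qed (rule bound)
  also have "\<dots> = C * measure \<nu> Y - \<delta> * (1 + \<delta> / C) ^ (2 * k) * \<kappa>"
    unfolding set_lebesgue_integral_def split
    by (subst Bochner_Integration.integral_diff[OF intU]) (simp add: \<kappa>_def)
  finally have "L ((1 - const_poly (1 / C) * g) ^ (2 * k) * g) < r" using k by linarith
  then show thesis by (rule that)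
qed

text \<open>
  The multiplier \<open>\<psi> v v\<^sup>T + I\<close> pairs with \<open>H\<close> to \<open>\<psi> v\<^sup>T H v + tr H\<close>; the square weight \<open>\<psi>\<close> makes the first
  moment arbitrarily negative, and the identity makes the multiplier definite.
\<close>
lemma multiplier_of_negative_value:
  fixes H :: "('m, real) mpoly^'q::finite^'q"
  assumes "y0 \<in> Y" "v \<bullet> (mat_eval H y0 *v v) < 0"
  obtains B where "symmetric B" "\<And>y. pos_def (mat_eval B y)" "L (frob B H) < r"
proof -
  define g where "g = (\<Sum>i\<in>UNIV. \<Sum>j\<in>UNIV. const_poly (v $ i * v $ j) * H $ i $ j)"
  have "peval g y = v \<bullet> (mat_eval H y *v v)" for y
    by (simp add: g_def peval_simps inner_matrix_vector_sum mat_eval_def)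
  then obtain c k where ck: "L ((1 - const_poly c * g) ^ (2 * k) * g) < r - L (frob (mat 1) H)"
    using concentrated_square_moment[of y0 g "r - L (frob (mat 1) H)"] assms by auto
  define \<psi> where "\<psi> = (1 - const_poly c * g) ^ (2 * k)"
  define B where "B = (\<chi> i j. const_poly (v $ i * v $ j) * \<psi> + mat 1 $ i $ j)"
  show thesis
  proof
    show sym: "symmetric B"
      by (auto simp: symmetric_iff B_def mat_def ac_simps)
    show "L (frob B H) < r"
      using ck unfolding B_def frob_rank_one_plus_id g_def[symmetric] \<psi>_def moment_add by simp
    show "pos_def (mat_eval B y)" for y
      unfolding pos_def_def
    proof (intro conjI allI impI)
      show "symmetric (mat_eval B y)"
        using sym by (simp add: symmetric_iff mat_eval_def)
      fix u :: "real^'q" assume "u \<noteq> 0"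
      have "u \<bullet> (mat_eval B y *v u) = peval \<psi> y * (\<Sum>i\<in>UNIV. \<Sum>j\<in>UNIV. (u $ i * v $ i) * (u $ j * v $ j))
          + (\<Sum>i\<in>UNIV. \<Sum>j\<in>UNIV. u $ i * u $ j * (mat 1 :: real^'q^'q) $ i $ j)"
      proof -
        have "peval (mat 1 $ i $ j) y = (mat 1 :: real^'q^'q) $ i $ j" for i j :: 'q
          by (simp add: mat_def)
        then show ?thesis
          by (simp add: inner_matrix_vector_sum mat_eval_def B_def peval_simps sum_distrib_left
              distrib_left sum.distrib ac_simps)
      qed
      also have "\<dots> = peval \<psi> y * (u \<bullet> v)\<^sup>2 + u \<bullet> u"
        using inner_mat_scalar[of u 1] unfolding inner_matrix_vector_sum
        by (simp add: inner_vec_def power2_eq_square sum_product)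
      also have "\<dots> > 0"
        using \<open>u \<noteq> 0\<close> by (intro add_nonneg_pos) (auto simp: \<psi>_def peval_power)
      finally show "0 < u \<bullet> (mat_eval B y *v u)" .
    qed
  qed
qed

text \<open>The multiplier is a small multiple of the identity.\<close>
lemma small_multiplier:
  fixes H :: "('m, real) mpoly^'q::finite^'q"
  assumes "r > 0"
  obtains B where "symmetric B" "\<And>y. pos_def (mat_eval B y)" "L (frob B H) < r"
proof -
  define \<epsilon> where "\<epsilon> = r / (\<bar>L (frob (mat 1) H)\<bar> + 1)"
  have "\<epsilon> > 0" using assms by (simp add: \<epsilon>_def)
  show thesis
  proof
    let ?B = "mat (const_poly \<epsilon>) :: ('m, real) mpoly^'q^'q"
    show "symmetric ?B" by (auto simp: symmetric_iff mat_def)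
    have "frob ?B H = const_poly \<epsilon> * frob (mat 1) H"
      by (auto simp: frob_def sum_distrib_left mat_def intro!: sum.cong)
    then have "L (frob ?B H) = \<epsilon> * L (frob (mat 1) H)" by (simp add: moment_const_mult)
    also have "\<dots> \<le> \<epsilon> * \<bar>L (frob (mat 1) H)\<bar>" using \<open>\<epsilon> > 0\<close> by simp
    also have "\<dots> < r" using assms by (simp add: \<epsilon>_def field_simps)
    finally show "L (frob ?B H) < r" .
    show "pos_def (mat_eval ?B y)" for y
    proof -
      have "mat_eval ?B y = mat \<epsilon>"
        by (auto simp: mat_eval_def mat_def vec_eq_iff peval_single)
      moreover have "symmetric (mat \<epsilon> :: real^'q^'q)" by (auto simp: symmetric_iff mat_def)
      ultimately show ?thesis
        using \<open>\<epsilon> > 0\<close> by (simp add: pos_def_def inner_mat_scalar)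
    qed
  qed
qed

end

section \<open>A continuous field of multipliers on the simplex\<close>
text \<open>The tube lemma, in the form of persistence of a strict inequality along a compact factor.\<close>
lemma positivity_near_compact_fibre:
  fixes f :: "'a::topological_space \<times> 'b::topological_space \<Rightarrow> real"
  assumes "compact K" "open U" "x0 \<in> U" "continuous_on (U \<times> K) f" "\<And>k. k \<in> K \<Longrightarrow> 0 < f (x0, k)"
  obtains V where "open V" "x0 \<in> V" "V \<subseteq> U" "\<And>x k. x \<in> V \<Longrightarrow> k \<in> K \<Longrightarrow> 0 < f (x, k)"
proof -
  obtain A where A: "open A" "A \<inter> (U \<times> K) = f -` {0<..} \<inter> (U \<times> K)"
    using assms(4) unfolding continuous_on_open_invariant by (metis open_greaterThan)
  have "open (A \<inter> (U \<times> UNIV))" "{x0} \<times> K \<subseteq> A \<inter> (U \<times> UNIV)"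
    using A assms by (auto intro!: open_Int open_Times)
  then obtain X where "x0 \<in> X" "open X" "X \<times> K \<subseteq> A \<inter> (U \<times> UNIV)"
    using Elementary_Topology.tube_lemma[OF \<open>compact K\<close>] by metis
  then show thesis
    using that[of "X \<inter> U"] A assms(2,3) by auto
qed

definition std_simplex :: "(real^'n::finite) set" where
  "std_simplex = {x. (\<forall>i. 0 \<le> x $ i) \<and> (\<Sum>i\<in>UNIV. x $ i) = 1}"

lemma compact_std_simplex: "compact (std_simplex :: (real^'n::finite) set)"
proof -
  have "closed (std_simplex :: (real^'n) set)"
    unfolding std_simplex_def by (intro closed_Collect_conj closed_Collect_all closed_Collect_le
        closed_Collect_eq continuous_intros)
  moreover have "norm x \<le> 1" if "x \<in> std_simplex" for x :: "real^'n"
    using norm_le_l1_cart[of x] that by (simp add: std_simplex_def)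
  then have "bounded (std_simplex :: (real^'n) set)" by (auto simp: bounded_iff)
  ultimately show ?thesis by (simp add: compact_eq_bounded_closed)
qed

lemma weighted_sum_pos:
  fixes w a :: "'i \<Rightarrow> real"
  assumes "finite D" "\<And>i. i \<in> D \<Longrightarrow> 0 \<le> w i" "sum w D = 1" "\<And>i. i \<in> D \<Longrightarrow> w i \<noteq> 0 \<Longrightarrow> 0 < a i"
  shows "0 < (\<Sum>i\<in>D. w i * a i)"
proof -
  obtain i where "i \<in> D" "w i \<noteq> 0"
    using assms(3) by (metis sum.neutral zero_neq_one)
  then have "0 < w i * a i" using assms(2,4) by (simp add: less_le)
  moreover have "0 \<le> w j * a j" if "j \<in> D" for j
    using assms(2,4)[OF that] by (cases "w j = 0") auto
  ultimately show ?thesis using \<open>finite D\<close> \<open>i \<in> D\<close> by (intro sum_pos2)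
qed

text \<open>
  The open set \<open>- K\<close> is added to the cover, so that the weights are continuous on the whole space. Its
  own weight vanishes on \<open>K\<close> and is dropped. The whole space matters because sample points such as
  \<open>(x - h \<gamma>) / (1 - e h)\<close> may leave the simplex.
\<close>
lemma finite_partition_of_unity:
  fixes \<D> :: "'a::metric_space set set"
  assumes "finite \<D>" "\<And>U. U \<in> \<D> \<Longrightarrow> open U" "closed K" "K \<subseteq> \<Union>\<D>"
  obtains w :: "'a set \<Rightarrow> 'a \<Rightarrow> real" where
    "\<And>U. U \<in> \<D> \<Longrightarrow> continuous_on UNIV (w U)" "\<And>U x. U \<in> \<D> \<Longrightarrow> 0 \<le> w U x"
    "\<And>U x. U \<in> \<D> \<Longrightarrow> x \<notin> U \<Longrightarrow> w U x = 0" "\<And>x. x \<in> K \<Longrightarrow> (\<Sum>U\<in>\<D>. w U x) = 1"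
proof -
  let ?C = "insert (- K) \<D>"
  have fin: "finite ?C" using assms by simp
  obtain w :: "'a set \<Rightarrow> 'a \<Rightarrow> real" where w:
    "\<And>U. U \<in> ?C \<Longrightarrow> continuous_on UNIV (w U) \<and> (\<forall>x \<in> UNIV. 0 \<le> w U x)"
    "\<And>x U. \<lbrakk>U \<in> ?C; x \<in> UNIV; x \<notin> U\<rbrakk> \<Longrightarrow> w U x = 0"
    "\<And>x. x \<in> UNIV \<Longrightarrow> supp_sum (\<lambda>U. w U x) ?C = 1"
  proof (rule subordinate_partition_of_unity[of UNIV ?C])
    show "UNIV \<subseteq> \<Union>?C" "\<And>T. T \<in> ?C \<Longrightarrow> open T" using assms by auto
    show "\<exists>V. open V \<and> x \<in> V \<and> finite {U \<in> ?C. U \<inter> V \<noteq> {}}" for x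
      using fin by (intro exI[of _ UNIV]) auto
  qed blast
  show thesis
  proof (rule that[of w])
    show "(\<Sum>U\<in>\<D>. w U x) = 1" if "x \<in> K" for x
    proof -
      have "supp_sum (\<lambda>U. w U x) ?C = (\<Sum>U\<in>\<D>. w U x)"
        unfolding supp_sum_def support_on_def
        by (rule sum.mono_neutral_cong) (use fin assms(1) w(2)[of "- K" x] that in auto)
      then show ?thesis using w(3)[of x] by simp
    qed
  qed (use w in auto)
qed

context compact_moments
begin

lemma moment_frob_specialize:
  assumes "homogeneous_of_degree e G"
  shows "L (frob B (specialize x G)) = (\<Sum>\<gamma>\<in>exponents e. monom_at \<gamma> x * L (frob B (mat_coeff G \<gamma>)))"
  by (simp add: frob_specialize[OF assms] moment_sum moment_const_mult)

text \<open>
  Requiring strict inequality against the quadratic form of \<open>F\<close> on the unit sphere makes the local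
  choice persist near \<open>x\<close>; it is also preserved by convex combinations of multipliers, so a
  partition of unity applies. A local multiplier has to push its moment below the least value \<open>\<mu>\<close>
  of the form: in \<open>X\<close> one has \<open>\<mu> > 0\<close> and a small multiplier suffices, outside \<open>X\<close> the moment can be
  made as negative as desired.
\<close>
lemma continuous_multiplier_field:
  fixes F :: "('n::finite, real) mpoly^'p::finite^'p"
    and G :: "('n, ('m, real) mpoly) mpoly^'q::finite^'q"
  assumes G: "symmetric G" "homogeneous_of_degree e G"
    and pos: "\<And>x. x \<in> std_simplex \<Longrightarrow> (\<And>y. y \<in> Y \<Longrightarrow> pos_semidef (mat_eval2 G x y)) \<Longrightarrow> pos_def (mat_eval F x)"
  obtains B :: "real^'n \<Rightarrow> ('m, real) mpoly^'q^'q" where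
    "\<And>x. symmetric (B x)"
    "\<And>x y. x \<in> std_simplex \<Longrightarrow> pos_def (mat_eval (B x) y)"
    "\<And>\<gamma>. continuous_on UNIV (\<lambda>x. L (frob (B x) (mat_coeff G \<gamma>)))"
    "\<And>x v. x \<in> std_simplex \<Longrightarrow> norm v = 1 \<Longrightarrow>
       L (frob (B x) (specialize x G)) < v \<bullet> (mat_eval F x *v v)"
proof -
  let ?gap = "\<lambda>B x v. v \<bullet> (mat_eval F x *v v) - L (frob B (specialize x G))"
  define good where "good = (\<lambda>B U. symmetric B \<and> (\<forall>y. pos_def (mat_eval B y)) \<and>
    (\<forall>x\<in>U. \<forall>v\<in>sphere 0 1. 0 < ?gap B x v))"
  have local: "\<exists>U B. open U \<and> x \<in> U \<and> good B U" if x: "x \<in> std_simplex" for x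
  proof -
    have cont: "continuous_on S (\<lambda>v. v \<bullet> (mat_eval F x *v v))" for x S
      unfolding inner_matrix_vector_sum by (intro continuous_intros)
    have ne: "sphere 0 1 \<noteq> ({} :: (real^'p) set)" by simp
    obtain v0 where v0: "v0 \<in> sphere 0 1"
      "\<And>v. v \<in> sphere 0 1 \<Longrightarrow> v0 \<bullet> (mat_eval F x *v v0) \<le> v \<bullet> (mat_eval F x *v v)"
      using continuous_attains_inf[OF compact_sphere ne cont] by blast
    define \<mu> where "\<mu> = v0 \<bullet> (mat_eval F x *v v0)"
    have "\<exists>B. symmetric B \<and> (\<forall>y. pos_def (mat_eval B y)) \<and> L (frob B (specialize x G)) < \<mu>"
    proof (cases "\<forall>y\<in>Y. pos_semidef (mat_eval2 G x y)")
      case True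
      then have "\<mu> > 0" using pos[OF x] v0(1) by (auto simp: pos_def_iff_unit \<mu>_def)
      then show ?thesis by (rule small_multiplier[of \<mu> "specialize x G"]) blast
    next
      case False
      then obtain y0 where y0: "y0 \<in> Y" "\<not> pos_semidef (mat_eval2 G x y0)" by blast
      moreover have "symmetric (mat_eval2 G x y0)"
        using G(1) by (simp add: symmetric_iff mat_eval2_def)
      ultimately obtain v where "v \<bullet> (mat_eval (specialize x G) y0 *v v) < 0"
        by (auto simp: pos_semidef_def not_le mat_eval_specialize)
      then show ?thesis by (rule multiplier_of_negative_value[OF y0(1), of v _ \<mu>]) blast
    qed
    then obtain B where B: "symmetric B" "\<And>y. pos_def (mat_eval B y)" "L (frob B (specialize x G)) < \<mu>"
      by blast
    define f where "f = (\<lambda>(x, v). ?gap B x v)"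
    have contf: "continuous_on (UNIV \<times> sphere 0 1) f"
      unfolding f_def inner_matrix_vector_sum mat_eval_def case_prod_unfold
        moment_frob_specialize[OF G(2)] vec_lambda_beta
      by (intro continuous_intros)
    have posf: "0 < f (x, v)" if "v \<in> sphere 0 1" for v
      using v0(2)[OF that] B(3) by (simp add: f_def \<mu>_def)
    obtain U where "open U" "x \<in> U" "\<And>z v. z \<in> U \<Longrightarrow> v \<in> sphere 0 1 \<Longrightarrow> 0 < f (z, v)"
      by (rule positivity_near_compact_fibre[OF compact_sphere open_UNIV UNIV_I contf posf]) blast+
    then show ?thesis using B unfolding good_def f_def by (intro exI[of _ U] exI[of _ B]) auto
  qed
  have "std_simplex \<subseteq> \<Union>{U. open U \<and> (\<exists>B. good B U)}"
    using local by blast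
  then obtain \<D> where \<D>: "\<D> \<subseteq> {U. open U \<and> (\<exists>B. good B U)}" "finite \<D>" "std_simplex \<subseteq> \<Union>\<D>"
    by (rule compactE[OF compact_std_simplex]) auto
  then have "\<forall>U\<in>\<D>. \<exists>B. good B U" by blast
  then obtain b where b: "\<And>U. U \<in> \<D> \<Longrightarrow> good (b U) U" using bchoice[of \<D>] by metis
  obtain w :: "(real^'n) set \<Rightarrow> real^'n \<Rightarrow> real" where w:
    "\<And>U. U \<in> \<D> \<Longrightarrow> continuous_on UNIV (w U)" "\<And>U x. U \<in> \<D> \<Longrightarrow> 0 \<le> w U x"
    "\<And>U x. U \<in> \<D> \<Longrightarrow> x \<notin> U \<Longrightarrow> w U x = 0" "\<And>x. x \<in> std_simplex \<Longrightarrow> (\<Sum>U\<in>\<D>. w U x) = 1"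
    using finite_partition_of_unity[OF \<D>(2) _ compact_imp_closed[OF compact_std_simplex] \<D>(3)] \<D>(1)
    by blast
  define B where "B = (\<lambda>x. \<chi> i j. \<Sum>U\<in>\<D>. const_poly (w U x) * b U $ i $ j)"
  have LB: "L (frob (B x) H) = (\<Sum>U\<in>\<D>. w U x * L (frob (b U) H))" for x H
  proof -
    have "frob (B x) H = (\<Sum>i\<in>UNIV. \<Sum>j\<in>UNIV. \<Sum>U\<in>\<D>. const_poly (w U x) * (b U $ i $ j * H $ i $ j))"
      by (simp add: frob_def B_def sum_distrib_right mult.assoc)
    also have "\<dots> = (\<Sum>U\<in>\<D>. \<Sum>i\<in>UNIV. \<Sum>j\<in>UNIV. const_poly (w U x) * (b U $ i $ j * H $ i $ j))"
      by (rule sum_entries_swap)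
    finally show ?thesis
      by (simp add: frob_def moment_sum moment_const_mult sum_distrib_left)
  qed
  show thesis
  proof (rule that[of B])
    show sym: "symmetric (B x)" for x
      using b by (auto simp: good_def symmetric_iff B_def intro!: sum.cong)
    show "continuous_on UNIV (\<lambda>x. L (frob (B x) (mat_coeff G \<gamma>)))" for \<gamma>
      unfolding LB by (intro continuous_intros w)
    show "pos_def (mat_eval (B x) y)" if x: "x \<in> std_simplex" for x y
      unfolding pos_def_def
    proof (intro conjI allI impI)
      show "symmetric (mat_eval (B x) y)"
        using sym by (simp add: symmetric_iff mat_eval_def)
      fix v :: "real^'q" assume "v \<noteq> 0"
      have "v \<bullet> (mat_eval (B x) y *v v) =
          (\<Sum>i\<in>UNIV. \<Sum>j\<in>UNIV. \<Sum>U\<in>\<D>. w U x * (v $ i * v $ j * mat_eval (b U) y $ i $ j))"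
        by (simp add: inner_matrix_vector_sum mat_eval_def B_def peval_simps sum_distrib_left ac_simps)
      also have "\<dots> = (\<Sum>U\<in>\<D>. \<Sum>i\<in>UNIV. \<Sum>j\<in>UNIV. w U x * (v $ i * v $ j * mat_eval (b U) y $ i $ j))"
        by (rule sum_entries_swap)
      also have "\<dots> = (\<Sum>U\<in>\<D>. w U x * (v \<bullet> (mat_eval (b U) y *v v)))"
        by (simp add: inner_matrix_vector_sum sum_distrib_left)
      also have "\<dots> > 0"
        using \<D>(2) w(2,4) x b \<open>v \<noteq> 0\<close>
        by (intro weighted_sum_pos) (auto simp: good_def pos_def_def)
      finally show "0 < v \<bullet> (mat_eval (B x) y *v v)" .
    qed
    show "L (frob (B x) (specialize x G)) < v \<bullet> (mat_eval F x *v v)"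
      if x: "x \<in> std_simplex" and v: "norm v = 1" for x v
    proof -
      have "0 < (\<Sum>U\<in>\<D>. w U x * ?gap (b U) x v)"
      proof (rule weighted_sum_pos[OF \<D>(2) w(2) w(4)[OF x]])
        fix U assume U: "U \<in> \<D>" "w U x \<noteq> 0"
        then have "x \<in> U" using w(3) by blast
        then show "0 < ?gap (b U) x v" using b[OF U(1)] v by (auto simp: good_def)
      qed
      also have "\<dots> = (\<Sum>U\<in>\<D>. w U x) * (v \<bullet> (mat_eval F x *v v)) - L (frob (B x) (specialize x G))"
        by (simp add: LB right_diff_distrib sum_subtractf sum_distrib_right)
      finally show ?thesis using w(4)[OF x] by simp
    qed
  qed
qed

end

section \<open>Sampling the field and passing to coefficients\<close>

lemma scaled_exponent_in_simplex:
  assumes "exp_deg \<alpha> = M" "M > 0"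
  shows "exp_vec \<alpha> /\<^sub>R real M \<in> std_simplex"
  using assms by (auto simp: std_simplex_def exp_vec_def exp_deg_def simp flip: sum_distrib_left of_nat_sum)

lemma multi_fact_pos: "multi_fact \<alpha> > 0"
  by (auto simp: multi_fact_def intro!: prod_pos)

lemma exp_deg_diff:
  assumes "\<gamma> + (\<alpha> - \<gamma>) = \<alpha>"
  shows "exp_deg \<alpha> = exp_deg \<gamma> + exp_deg (\<alpha> - \<gamma>)"
  using exp_deg_add[of \<gamma> "\<alpha> - \<gamma>"] assms by simp

text \<open>
  The ratio \<open>\<alpha>!/(\<alpha> - \<gamma>)!\<close> in the multinomial coefficients becomes a falling monomial at the grid point
  \<open>\<alpha>/M\<close>, once the factor \<open>N! M\<^sup>d / \<alpha>!\<close> that depends on \<open>\<alpha>\<close> alone is taken out.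
\<close>
lemma lookup_sum_vars_power_mult:
  fixes f :: "('n::finite, real) mpoly"
  assumes f: "Poly_Mapping.keys f \<subseteq> exponents d" and M: "M = N + d" "M > 0"
  shows "Poly_Mapping.lookup ((\<Sum>k\<in>UNIV. mvar k) ^ N * f) \<alpha> =
    (if exp_deg \<alpha> = M then fact N * real M ^ d / multi_fact \<alpha> *
       (\<Sum>\<gamma>\<in>exponents d. Poly_Mapping.lookup f \<gamma> * falling_monom \<gamma> (1 / real M) (exp_vec \<alpha> /\<^sub>R real M)) else 0)"
proof -
  have "Poly_Mapping.lookup ((\<Sum>k\<in>UNIV. mvar k) ^ N * f) \<alpha> =
    (\<Sum>\<gamma>\<in>exponents d. if \<gamma> + (\<alpha> - \<gamma>) = \<alpha> then Poly_Mapping.lookup f \<gamma> *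
      (if exp_deg (\<alpha> - \<gamma>) = N then fact N / multi_fact (\<alpha> - \<gamma>) else 0) else 0)"
    by (subst mult.commute, subst lookup_mult_sum[OF finite_exponents f])
      (simp only: lookup_sum_vars_power)
  also have "\<dots> = (\<Sum>\<gamma>\<in>exponents d. if exp_deg \<alpha> = M then fact N * real M ^ d / multi_fact \<alpha> *
       (Poly_Mapping.lookup f \<gamma> * falling_monom \<gamma> (1 / real M) (exp_vec \<alpha> /\<^sub>R real M)) else 0)"
  proof (intro sum.cong refl)
    fix \<gamma> :: "'n \<Rightarrow>\<^sub>0 nat" assume "\<gamma> \<in> exponents d"
    then have \<gamma>: "exp_deg \<gamma> = d" by (simp add: exponents_def)
    have scaled: "falling_monom \<gamma> (1 / real M) (exp_vec \<alpha> /\<^sub>R real M) =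
      (if \<gamma> + (\<alpha> - \<gamma>) = \<alpha> then multi_fact \<alpha> / multi_fact (\<alpha> - \<gamma>) else 0) / real M ^ d"
      using falling_monom_scaled[of "real M" \<gamma> \<alpha>] M \<gamma> by simp
    show "(if \<gamma> + (\<alpha> - \<gamma>) = \<alpha> then Poly_Mapping.lookup f \<gamma> *
        (if exp_deg (\<alpha> - \<gamma>) = N then fact N / multi_fact (\<alpha> - \<gamma>) else 0) else 0) =
      (if exp_deg \<alpha> = M then fact N * real M ^ d / multi_fact \<alpha> *
        (Poly_Mapping.lookup f \<gamma> * falling_monom \<gamma> (1 / real M) (exp_vec \<alpha> /\<^sub>R real M)) else 0)"
    proof (cases "\<gamma> + (\<alpha> - \<gamma>) = \<alpha>")
      case True
      then have "exp_deg (\<alpha> - \<gamma>) = N \<longleftrightarrow> exp_deg \<alpha> = M"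
        using exp_deg_diff[OF True] \<gamma> M by auto
      then show ?thesis
        unfolding scaled using True M(2) multi_fact_pos[of \<alpha>] by simp
    next
      case False
      then show ?thesis unfolding scaled by simp
    qed
  qed
  finally show ?thesis by (simp add: sum_distrib_left)
qed

text \<open>
  A homogeneous polynomial of degree \<open>K\<close> whose coefficients are samples of \<open>B\<close> on the grid \<open>\<alpha>/K\<close> in the
  simplex. For \<open>c \<alpha> = K!/\<alpha>!\<close> this would be the Bernstein polynomial of \<open>B\<close>.
\<close>
definition sampled ::
  "nat \<Rightarrow> (('n::finite \<Rightarrow>\<^sub>0 nat) \<Rightarrow> real) \<Rightarrow> (real^'n \<Rightarrow> ('m, real) mpoly^'q::finite^'q)
    \<Rightarrow> ('n, ('m, real) mpoly) mpoly^'q^'q" where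
  "sampled K c B = (\<chi> k l. \<Sum>\<alpha>\<in>exponents K.
     Poly_Mapping.single \<alpha> (const_poly (c \<alpha>) * B (exp_vec \<alpha> /\<^sub>R K) $ k $ l))"

lemma lookup_sampled:
  "Poly_Mapping.lookup (sampled K c B $ k $ l) \<alpha> =
    (if exp_deg \<alpha> = K then const_poly (c \<alpha>) * B (exp_vec \<alpha> /\<^sub>R K) $ k $ l else 0)"
proof -
  have "Poly_Mapping.lookup (sampled K c B $ k $ l) \<alpha> = (\<Sum>\<beta>\<in>exponents K.
      if \<beta> = \<alpha> then const_poly (c \<beta>) * B (exp_vec \<beta> /\<^sub>R K) $ k $ l else 0)"
    by (simp add: sampled_def lookup_sum lookup_single when_def)
  also have "\<dots> = (if \<alpha> \<in> exponents K then const_poly (c \<alpha>) * B (exp_vec \<alpha> /\<^sub>R K) $ k $ l else 0)"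
    by (rule sum.delta[OF finite_exponents])
  finally show ?thesis by (simp add: exponents_def)
qed

lemma mat_coeff_kron_id: "mat_coeff (kron (mat 1) Q) \<alpha> = kron (mat 1) (mat_coeff Q \<alpha>)"
  for Q :: "('n, ('m, real) mpoly) mpoly^'q::finite^'q"
  by (auto simp: mat_coeff_def kron_def mat_def vec_eq_iff)

lemma mat_eval_kron_id: "mat_eval (kron (mat 1) Q) y = kron (mat 1) (mat_eval Q y)"
  for Q :: "('m::finite, real) mpoly^'q::finite^'q"
  by (auto simp: mat_eval_def kron_def mat_def vec_eq_iff)

lemma pos_def_sampled:
  assumes "exp_deg \<alpha> = K" "c \<alpha> > 0" "pos_def (mat_eval (B (exp_vec \<alpha> /\<^sub>R K)) y)"
  shows "pos_def (mat_eval (mat_coeff (sampled K c B) \<alpha>) y)"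
proof -
  let ?E = "mat_eval (B (exp_vec \<alpha> /\<^sub>R K)) y"
  have entry: "mat_eval (mat_coeff (sampled K c B) \<alpha>) y $ i $ j = c \<alpha> * ?E $ i $ j" for i j
    using assms(1) by (simp add: mat_eval_def mat_coeff_def lookup_sampled peval_simps)
  then have "v \<bullet> (mat_eval (mat_coeff (sampled K c B) \<alpha>) y *v v) = c \<alpha> * (v \<bullet> (?E *v v))" for v
    unfolding inner_matrix_vector_sum by (simp add: sum_distrib_left ac_simps)
  then show ?thesis
    using assms(2,3) entry by (simp add: pos_def_def symmetric_iff)
qed

text \<open>
  The difference of the two sides is continuous in \<open>(h, x, v)\<close> as long as \<open>e h < 1\<close>, and at \<open>h = 0\<close> it is
  the positive gap between the quadratic form of \<open>F\<close> and the multiplier term. As \<open>(x, v)\<close> ranges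
  over a compact set, positivity extends to a neighbourhood of \<open>h = 0\<close> that does not depend on it.
\<close>
lemma eventually_positive_falling_form:
  fixes F :: "('n::finite, real) mpoly^'p::finite^'p"
    and u :: "('n \<Rightarrow>\<^sub>0 nat) \<Rightarrow> real^'n \<Rightarrow> real"
  assumes F: "homogeneous_of_degree d F"
    and u: "\<And>\<gamma>. continuous_on UNIV (u \<gamma>)"
    and pos: "\<And>x v. x \<in> std_simplex \<Longrightarrow> norm v = 1 \<Longrightarrow>
      (\<Sum>\<gamma>\<in>exponents e. monom_at \<gamma> x * u \<gamma> x) < v \<bullet> (mat_eval F x *v v)"
  obtains h0 where "h0 > 0"
    "\<And>h x v. 0 < h \<Longrightarrow> h < h0 \<Longrightarrow> x \<in> std_simplex \<Longrightarrow> norm v = 1 \<Longrightarrow>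
      (\<Sum>\<gamma>\<in>exponents e. falling_monom \<gamma> h x * u \<gamma> ((x - h *\<^sub>R exp_vec \<gamma>) /\<^sub>R (1 - real e * h))) <
      (\<Sum>i\<in>UNIV. \<Sum>j\<in>UNIV. v $ i * v $ j *
        (\<Sum>\<gamma>\<in>exponents d. Poly_Mapping.lookup (F $ i $ j) \<gamma> * falling_monom \<gamma> h x))"
proof -
  define U where "U = {h::real. real e * h < 1}"
  define f :: "real \<times> (real^'n) \<times> (real^'p) \<Rightarrow> real" where
    "f = (\<lambda>(h, x, v). (\<Sum>i\<in>UNIV. \<Sum>j\<in>UNIV. v $ i * v $ j *
        (\<Sum>\<gamma>\<in>exponents d. Poly_Mapping.lookup (F $ i $ j) \<gamma> * falling_monom \<gamma> h x)) -
      (\<Sum>\<gamma>\<in>exponents e. falling_monom \<gamma> h x * u \<gamma> ((x - h *\<^sub>R exp_vec \<gamma>) /\<^sub>R (1 - real e * h))))"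
  let ?K = "std_simplex \<times> sphere 0 1 :: ((real^'n) \<times> (real^'p)) set"
  have K: "compact ?K"
    by (intro compact_Times compact_std_simplex compact_sphere)
  have U: "open U" "0 \<in> U"
    unfolding U_def by (auto intro!: open_Collect_less continuous_intros)
  have cont: "continuous_on (U \<times> ?K) f"
  proof -
    have cu: "continuous_on S (\<lambda>z. u \<gamma> (g z))" if "continuous_on S g" for \<gamma> S and g :: "real \<times> (real^'n) \<times> (real^'p) \<Rightarrow> real^'n"
      by (rule continuous_on_compose2[OF u that]) auto
    show ?thesis
      unfolding f_def falling_monom_def case_prod_unfold
      by (intro continuous_intros cu) (auto simp: U_def)
  qed
  have "0 < f (0, k)" if "k \<in> ?K" for k
  proof -
    obtain x v where k: "k = (x, v)" "x \<in> std_simplex" "norm v = 1" using \<open>k \<in> ?K\<close> by (cases k) auto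
    \<comment> \<open>At \<open>h = 0\<close> the falling monomials are monomials, and \<open>u\<close> is evaluated at \<open>x\<close> itself.\<close>
    have "peval (F $ i $ j) x = (\<Sum>\<gamma>\<in>exponents d. Poly_Mapping.lookup (F $ i $ j) \<gamma> * monom_at \<gamma> x)" for i j
      using F by (intro peval_superset finite_exponents) (auto simp: homogeneous_of_degree_def exponents_def)
    then have "v \<bullet> (mat_eval F x *v v) = (\<Sum>i\<in>UNIV. \<Sum>j\<in>UNIV. v $ i * v $ j *
        (\<Sum>\<gamma>\<in>exponents d. Poly_Mapping.lookup (F $ i $ j) \<gamma> * monom_at \<gamma> x))"
      by (simp add: inner_matrix_vector_sum mat_eval_def)
    then show ?thesis using pos[OF k(2,3)] by (simp add: f_def k(1) falling_monom_0)
  qed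
  then obtain V where V: "open V" "0 \<in> V" "\<And>h k. h \<in> V \<Longrightarrow> k \<in> ?K \<Longrightarrow> 0 < f (h, k)"
    by (rule positivity_near_compact_fibre[OF K U cont]) blast+
  obtain h0 where h0: "h0 > 0" "ball 0 h0 \<subseteq> V"
    using V(1,2) open_contains_ball by blast
  show thesis
  proof (rule that[OF h0(1)])
    fix h :: real and x :: "real^'n" and v :: "real^'p"
    assume "0 < h" "h < h0" "x \<in> std_simplex" "norm v = 1"
    then have "0 < f (h, x, v)" using h0 by (intro V(3)) auto
    then show "(\<Sum>\<gamma>\<in>exponents e. falling_monom \<gamma> h x * u \<gamma> ((x - h *\<^sub>R exp_vec \<gamma>) /\<^sub>R (1 - real e * h))) <
      (\<Sum>i\<in>UNIV. \<Sum>j\<in>UNIV. v $ i * v $ j *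
        (\<Sum>\<gamma>\<in>exponents d. Poly_Mapping.lookup (F $ i $ j) \<gamma> * falling_monom \<gamma> h x))"
      by (simp add: f_def)
  qed
qed

context compact_moments
begin

definition field_coeff :: "(real^'n \<Rightarrow> ('m, real) mpoly^'q::finite^'q) \<Rightarrow> ('n::finite, ('m, real) mpoly) mpoly^'q^'q
    \<Rightarrow> ('n \<Rightarrow>\<^sub>0 nat) \<Rightarrow> real^'n \<Rightarrow> real" where
  "field_coeff B G \<gamma> x = L (frob (B x) (mat_coeff G \<gamma>))"

lemma moment_lookup_frob_sampled:
  assumes G: "homogeneous_of_degree e G"
  shows "L (Poly_Mapping.lookup (frob (sampled K c B) G) \<alpha>) =
    (\<Sum>\<gamma>\<in>exponents e. if \<gamma> + (\<alpha> - \<gamma>) = \<alpha> \<and> exp_deg (\<alpha> - \<gamma>) = K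
       then c (\<alpha> - \<gamma>) * field_coeff B G \<gamma> (exp_vec (\<alpha> - \<gamma>) /\<^sub>R K) else 0)"
proof -
  have keys: "Poly_Mapping.keys (G $ k $ l) \<subseteq> exponents e" for k l
    using G by (auto simp: homogeneous_of_degree_def exponents_def)
  have one: "Poly_Mapping.lookup (sampled K c B $ k $ l * G $ k $ l) \<alpha> =
    (\<Sum>\<gamma>\<in>exponents e. if \<gamma> + (\<alpha> - \<gamma>) = \<alpha> \<and> exp_deg (\<alpha> - \<gamma>) = K then
       const_poly (c (\<alpha> - \<gamma>)) * (B (exp_vec (\<alpha> - \<gamma>) /\<^sub>R K) $ k $ l * mat_coeff G \<gamma> $ k $ l) else 0)" for k l
    by (subst mult.commute, subst lookup_mult_sum[OF finite_exponents keys])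
      (auto simp: lookup_sampled mat_coeff_def ac_simps intro!: sum.cong)
  have "Poly_Mapping.lookup (frob (sampled K c B) G) \<alpha> =
    (\<Sum>k\<in>UNIV. \<Sum>l\<in>UNIV. Poly_Mapping.lookup (sampled K c B $ k $ l * G $ k $ l) \<alpha>)"
    by (simp add: frob_def lookup_sum)
  also have "\<dots> = (\<Sum>\<gamma>\<in>exponents e. \<Sum>k\<in>UNIV. \<Sum>l\<in>UNIV. if \<gamma> + (\<alpha> - \<gamma>) = \<alpha> \<and> exp_deg (\<alpha> - \<gamma>) = K then
       const_poly (c (\<alpha> - \<gamma>)) * (B (exp_vec (\<alpha> - \<gamma>) /\<^sub>R K) $ k $ l * mat_coeff G \<gamma> $ k $ l) else 0)"
    unfolding one by (rule sum_entries_swap)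
  also have "\<dots> = (\<Sum>\<gamma>\<in>exponents e. if \<gamma> + (\<alpha> - \<gamma>) = \<alpha> \<and> exp_deg (\<alpha> - \<gamma>) = K then
       const_poly (c (\<alpha> - \<gamma>)) * frob (B (exp_vec (\<alpha> - \<gamma>) /\<^sub>R K)) (mat_coeff G \<gamma>) else 0)"
    by (intro sum.cong refl) (auto simp: frob_def sum_distrib_left)
  finally show ?thesis
    by (simp add: moment_sum if_distrib moment_const_mult field_coeff_def cong: if_cong)
qed

lemma lookup_mat_integral_scalar:
  "Poly_Mapping.lookup (mat_integral \<nu> Y (mat h) $ i $ j) \<alpha> =
    (if i = j then L (Poly_Mapping.lookup h \<alpha>) else 0)"
  by (auto simp: mat_integral_def mat_def Poly_Mapping.map.rep_eq when_def)

text \<open>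
  The normalisation \<open>c\<close> is chosen so that the factor \<open>a/\<alpha>!\<close> taken out here agrees, for \<open>a = N! M\<^sup>d\<close>, with
  the one for the power of the sum of variables times \<open>F\<close>. The sample point \<open>(\<alpha> - \<gamma>)/K\<close> is expressed by
  \<open>\<alpha>/M\<close> and \<open>1/M\<close>, using \<open>K/M = 1 - e/M\<close>.
\<close>
lemma moment_lookup_falling:
  fixes G :: "('n::finite, ('m, real) mpoly) mpoly^'q::finite^'q"
  assumes G: "homogeneous_of_degree e G" and M: "M = K + e" "K > 0"
    and c: "\<And>\<alpha>. c \<alpha> = a / real M ^ e / multi_fact \<alpha>"
  shows "L (Poly_Mapping.lookup (frob (sampled K c B) G) \<alpha>) =
    (if exp_deg \<alpha> = M then a / multi_fact \<alpha> * (\<Sum>\<gamma>\<in>exponents e. falling_monom \<gamma> (1 / real M) (exp_vec \<alpha> /\<^sub>R real M) *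
       field_coeff B G \<gamma> ((exp_vec \<alpha> /\<^sub>R real M - (1 / real M) *\<^sub>R exp_vec \<gamma>) /\<^sub>R (1 - real e * (1 / real M)))) else 0)"
proof -
  have arg: "exp_vec (\<alpha> - \<gamma>) /\<^sub>R K = (exp_vec \<alpha> /\<^sub>R real M - (1 / real M) *\<^sub>R exp_vec \<gamma>) /\<^sub>R (1 - real e * (1 / real M))"
    if "\<gamma> + (\<alpha> - \<gamma>) = \<alpha>" for \<gamma>
  proof -
    have "exp_vec \<alpha> = exp_vec \<gamma> + exp_vec (\<alpha> - \<gamma>)"
      by (subst that[symmetric]) (simp add: exp_vec_def vec_eq_iff lookup_add)
    moreover have "1 - real e * (1 / M) = K / M" using M by (simp add: field_simps)
    ultimately show ?thesis using M by (simp add: field_simps)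
  qed
  have "L (Poly_Mapping.lookup (frob (sampled K c B) G) \<alpha>) =
    (\<Sum>\<gamma>\<in>exponents e. if exp_deg \<alpha> = M then a / multi_fact \<alpha> * (falling_monom \<gamma> (1 / real M) (exp_vec \<alpha> /\<^sub>R real M) *
       field_coeff B G \<gamma> ((exp_vec \<alpha> /\<^sub>R real M - (1 / real M) *\<^sub>R exp_vec \<gamma>) /\<^sub>R (1 - real e * (1 / real M)))) else 0)"
    unfolding moment_lookup_frob_sampled[OF G]
  proof (intro sum.cong refl)
    fix \<gamma> :: "'n \<Rightarrow>\<^sub>0 nat" assume "\<gamma> \<in> exponents e"
    then have \<gamma>: "exp_deg \<gamma> = e" by (simp add: exponents_def)
    show "(if \<gamma> + (\<alpha> - \<gamma>) = \<alpha> \<and> exp_deg (\<alpha> - \<gamma>) = K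
       then c (\<alpha> - \<gamma>) * field_coeff B G \<gamma> (exp_vec (\<alpha> - \<gamma>) /\<^sub>R K) else 0) =
      (if exp_deg \<alpha> = M then a / multi_fact \<alpha> * (falling_monom \<gamma> (1 / real M) (exp_vec \<alpha> /\<^sub>R real M) *
       field_coeff B G \<gamma> ((exp_vec \<alpha> /\<^sub>R real M - (1 / real M) *\<^sub>R exp_vec \<gamma>) /\<^sub>R (1 - real e * (1 / real M)))) else 0)"
    proof (cases "\<gamma> + (\<alpha> - \<gamma>) = \<alpha>")
      case True
      have "exp_deg (\<alpha> - \<gamma>) = K \<longleftrightarrow> exp_deg \<alpha> = M"
        using exp_deg_diff[OF True] \<gamma> M by auto
      moreover have "c (\<alpha> - \<gamma>) = a / multi_fact \<alpha> * falling_monom \<gamma> (1 / real M) (exp_vec \<alpha> /\<^sub>R real M)"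
        using True M multi_fact_pos[of \<alpha>] by (simp add: falling_monom_scaled c \<gamma>)
      ultimately show ?thesis using True arg[OF True] by simp
    next
      case False
      then have "falling_monom \<gamma> (1 / real M) (exp_vec \<alpha> /\<^sub>R real M) = 0"
        using M by (subst falling_monom_scaled) auto
      then show ?thesis using False by simp
    qed
  qed
  then show ?thesis by (simp add: sum_distrib_left)
qed

end

theorem theoremD:
  fixes Y :: "(real^'m::finite) set"
    and \<nu> :: "(real^'m) measure"
    and F :: "('n::finite, real) mpoly^'p::finite^'p"
    and G :: "('n, ('m, real) mpoly) mpoly^'q::finite^'q"
    and X :: "(real^'n) set"
  assumes "compact Y"
    and "sets \<nu> = sets borel"
    and "measure_support \<nu> = Y"
    and "\<And>h :: ('m, real) mpoly. (\<integral>\<^sup>+y\<in>Y. ennreal \<bar>peval h y\<bar> \<partial>\<nu>) < \<infinity>"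
    and "symmetric F" and "homogeneous F"
    and "symmetric G" and "homogeneous G"
    and "X = {x. \<forall>y\<in>Y. pos_semidef (mat_eval2 G x y)}"
    and "\<And>x. x \<in> ({x. \<forall>i. 0 \<le> x $ i} \<inter> X) - {0} \<Longrightarrow> pos_def (mat_eval F x)"
  shows "\<exists>(N::nat) (P0 :: ('n, real) mpoly^'p^'p)
            (P :: ('n, ('m, real) mpoly) mpoly^('p \<times> 'q)^('p \<times> 'q)).
           mat_deg G \<le> N + mat_deg F \<and>
           symmetric P0 \<and> homogeneous_of_degree (N + mat_deg F) P0 \<and>
           symmetric P \<and> homogeneous_of_degree (N + mat_deg F - mat_deg G) P \<and>
           (\<forall>\<alpha>. exp_deg \<alpha> = N + mat_deg F \<longrightarrow> pos_def (mat_coeff P0 \<alpha>)) \<and>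
           (\<forall>\<alpha>. exp_deg \<alpha> = N + mat_deg F - mat_deg G \<longrightarrow>
              (\<forall>y\<in>Y. pos_def (mat_eval (mat_coeff P \<alpha>) y))) \<and>
           (\<chi> i j. (\<Sum>k\<in>UNIV. mvar k) ^ N * F $ i $ j)
             = P0 + mat_integral \<nu> Y (inner_p P G)"
proof -
  interpret compact_moments Y \<nu>
    using assms(1-4) by unfold_locales
  define d e where "d = mat_deg F" and "e = mat_deg G"
  have F: "homogeneous_of_degree d F" and G: "homogeneous_of_degree e G"
    using assms(6,8) by (auto simp: d_def e_def intro: homogeneous_mat_deg)
  have posF: "pos_def (mat_eval F x)"
    if "x \<in> std_simplex" "\<And>y. y \<in> Y \<Longrightarrow> pos_semidef (mat_eval2 G x y)" for x
    using that by (intro assms(10)) (auto simp: assms(9) std_simplex_def)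
  obtain B :: "real^'n \<Rightarrow> ('m, real) mpoly^'q^'q" where B:
    "\<And>x. symmetric (B x)"
    "\<And>x y. x \<in> std_simplex \<Longrightarrow> pos_def (mat_eval (B x) y)"
    "\<And>\<gamma>. continuous_on UNIV (\<lambda>x. L (frob (B x) (mat_coeff G \<gamma>)))"
    "\<And>x v. x \<in> std_simplex \<Longrightarrow> norm v = 1 \<Longrightarrow>
       L (frob (B x) (specialize x G)) < v \<bullet> (mat_eval F x *v v)"
    using continuous_multiplier_field[OF assms(7) G posF] by blast
  obtain h0 where h0: "h0 > 0" and gap:
    "\<And>h x v. 0 < h \<Longrightarrow> h < h0 \<Longrightarrow> x \<in> std_simplex \<Longrightarrow> norm v = 1 \<Longrightarrow>
      (\<Sum>\<gamma>\<in>exponents e. falling_monom \<gamma> h x * field_coeff B G \<gamma> ((x - h *\<^sub>R exp_vec \<gamma>) /\<^sub>R (1 - real e * h))) <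
      (\<Sum>i\<in>UNIV. \<Sum>j\<in>UNIV. v $ i * v $ j *
        (\<Sum>\<gamma>\<in>exponents d. Poly_Mapping.lookup (F $ i $ j) \<gamma> * falling_monom \<gamma> h x))"
    using eventually_positive_falling_form[OF F, of "field_coeff B G" e] B(3,4)
    unfolding field_coeff_def[abs_def] moment_frob_specialize[OF G] by blast
  obtain N0 where N0: "inverse (real (Suc N0)) < h0"
    using reals_Archimedean[OF h0] by blast
  \<comment> \<open>Two demands on \<open>N\<close>: \<open>N > e\<close> makes \<open>K\<close> positive, so that \<open>\<alpha>/K\<close> lies in the simplex, and
     \<open>M \<ge> N0 + 1\<close> makes \<open>1/M\<close> smaller than \<open>h0\<close>.\<close>
  define N M K where "N = e + Suc N0" and "M = N + d" and "K = M - e"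
  have MK: "M = K + e" "K > 0" "M > 0" by (auto simp: N_def M_def K_def)
  have h: "0 < 1 / real M" "1 / real M < h0"
  proof -
    have "1 / real M \<le> inverse (real (Suc N0))"
      unfolding inverse_eq_divide by (intro divide_left_mono) (auto simp: M_def N_def)
    then show "1 / real M < h0" using N0 by linarith
  qed (use MK in simp)
  define a where "a = fact N * real M ^ d"
  define c where "c = (\<lambda>\<alpha> :: 'n \<Rightarrow>\<^sub>0 nat. a / real M ^ e / multi_fact \<alpha>)"
  have a: "a > 0" using MK by (simp add: a_def)
  have c: "c \<alpha> > 0" for \<alpha>
    unfolding c_def using a MK(3) by (intro divide_pos_pos zero_less_power multi_fact_pos) auto
  define Q where "Q = sampled K c B"
  define P :: "('n, ('m, real) mpoly) mpoly^('p \<times> 'q)^('p \<times> 'q)" where "P = kron (mat 1) Q"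
  define SF where "SF = (\<chi> i j. (\<Sum>k\<in>UNIV. mvar k) ^ N * F $ i $ j)"
  define P0 where "P0 = SF - mat_integral \<nu> Y (inner_p P G)"
  define r where "r = (\<lambda>\<alpha>. \<Sum>\<gamma>\<in>exponents e. falling_monom \<gamma> (1 / real M) (exp_vec \<alpha> /\<^sub>R real M) *
       field_coeff B G \<gamma> ((exp_vec \<alpha> /\<^sub>R real M - (1 / real M) *\<^sub>R exp_vec \<gamma>) /\<^sub>R (1 - real e * (1 / real M))))"
  define s where "s = (\<lambda>\<alpha> i j. \<Sum>\<gamma>\<in>exponents d. Poly_Mapping.lookup (F $ i $ j) \<gamma> *
       falling_monom \<gamma> (1 / real M) (exp_vec \<alpha> /\<^sub>R real M))"
  have keysF: "Poly_Mapping.keys (F $ i $ j) \<subseteq> exponents d" for i j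
    using F by (auto simp: homogeneous_of_degree_def exponents_def)
  have P0_coeff: "Poly_Mapping.lookup (P0 $ i $ j) \<alpha> =
      (if exp_deg \<alpha> = M then a / multi_fact \<alpha> * (s \<alpha> i j - (if i = j then r \<alpha> else 0)) else 0)" for i j \<alpha>
    unfolding P0_def SF_def P_def inner_p_kron_id vector_minus_component lookup_minus Q_def
      lookup_mat_integral_scalar moment_lookup_falling[OF G MK(1,2) c_def[THEN fun_cong]]
      vec_lambda_beta lookup_sum_vars_power_mult[OF keysF M_def MK(3)]
    by (auto simp: s_def r_def a_def algebra_simps)
  have symQ: "symmetric Q"
    unfolding symmetric_iff
    by (intro allI poly_mapping_eqI) (use B(1) in \<open>simp add: Q_def lookup_sampled symmetric_iff\<close>)
  have symF: "F $ i $ j = F $ j $ i" for i j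
    using assms(5) by (simp add: symmetric_iff)
  have symP0: "symmetric P0"
    unfolding symmetric_iff
    by (intro allI poly_mapping_eqI) (auto simp: P0_coeff s_def symF[of i j for i j])
  have posP0: "pos_def (mat_coeff P0 \<alpha>)" if \<alpha>: "exp_deg \<alpha> = M" for \<alpha>
    unfolding pos_def_iff_unit
  proof (intro conjI ballI)
    show "symmetric (mat_coeff P0 \<alpha>)"
      using symP0 by (simp add: symmetric_iff mat_coeff_def)
    fix v :: "real^'p" assume "v \<in> sphere 0 1"
    then have v: "norm v = 1" by simp
    have "v \<bullet> (mat_coeff P0 \<alpha> *v v) = a / multi_fact \<alpha> *
        (\<Sum>i\<in>UNIV. \<Sum>j\<in>UNIV. v $ i * v $ j * (s \<alpha> i j - mat (r \<alpha>) $ i $ j))"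
      unfolding inner_matrix_vector_sum
      by (simp add: mat_coeff_def P0_coeff \<alpha> mat_def sum_distrib_left ac_simps)
    also have "(\<Sum>i\<in>UNIV. \<Sum>j\<in>UNIV. v $ i * v $ j * (s \<alpha> i j - mat (r \<alpha>) $ i $ j)) =
        (\<Sum>i\<in>UNIV. \<Sum>j\<in>UNIV. v $ i * v $ j * s \<alpha> i j) - v \<bullet> (mat (r \<alpha>) *v v)"
      unfolding inner_matrix_vector_sum by (simp add: right_diff_distrib sum_subtractf)
    also have "v \<bullet> (mat (r \<alpha>) *v v) = r \<alpha>"
      using v by (simp add: inner_mat_scalar norm_eq_1)
    also have "0 < a / multi_fact \<alpha> * ((\<Sum>i\<in>UNIV. \<Sum>j\<in>UNIV. v $ i * v $ j * s \<alpha> i j) - r \<alpha>)"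
      using gap[OF h scaled_exponent_in_simplex[OF \<alpha> MK(3)] v] a multi_fact_pos[of \<alpha>]
      by (simp add: s_def r_def)
    finally show "0 < v \<bullet> (mat_coeff P0 \<alpha> *v v)" .
  qed
  have "homogeneous_of_degree M P0"
    by (auto simp: homogeneous_of_degree_def in_keys_iff P0_coeff split: if_splits)
  moreover have "symmetric P"
    unfolding P_def by (intro symmetric_kron_id symQ)
  moreover have "homogeneous_of_degree K P"
    by (auto simp: homogeneous_of_degree_def in_keys_iff P_def kron_def mat_def Q_def lookup_sampled
        split: if_splits)
  moreover have "pos_def (mat_eval (mat_coeff P \<alpha>) y)" if "exp_deg \<alpha> = K" for \<alpha> y
    unfolding P_def mat_coeff_kron_id mat_eval_kron_id Q_def
    using that c MK by (intro pos_def_kron_id pos_def_sampled B(2) scaled_exponent_in_simplex) auto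
  moreover have "e \<le> M" using MK by simp
  moreover have "SF = P0 + mat_integral \<nu> Y (inner_p P G)"
    by (simp add: P0_def)
  ultimately show ?thesis
    using symP0 posP0 unfolding SF_def K_def M_def d_def e_def
    by (intro exI[of _ N] exI[of _ P0] exI[of _ P]) blast
qed

end
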